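(* Let $\{(z_n,x_n,y_n): n\ge 1\}$ be generated by the algorithm GRPDA-L (defined in the context), from arbitrary admissible parameters and starting points. Then $\{(x_n,y_n): n\ge 1\}$ converges to a solution of the saddle point problem $\min_{x\in\mathbb{R}^q}\max_{y\in\mathbb{R}^p} \mathcal{L}(x,y)$, i.e., to an element of $\Omega$.
   Context: Setting. $\mathbb{R}^p,\mathbb{R}^q$ are finite-dimensional Euclidean spaces with inner product $\langle\cdot,\cdot\rangle$ and induced norm $\|\cdot\|$; $f:\mathbb{R}^p\to(-\infty,+\infty]$ and $g:\mathbb{R}^q\to(-\infty,+\infty]$ are closed proper convex functions; $K\in\mathbb{R}^{p\times q}$ is a linear map from $\mathbb{R}^q$ to $\mathbb{R}^p$ with adjoint $K^\top$; $f^*(y)=\sup_{x}\{\langle y,x\rangle-f(x)\}$ is the Legendre-Fenchel conjugate. Put $\mathcal{L}(x,y)=g(x)+\langle Kx,y\rangle-f^*(y)$. Standing assumption: the set of minimizers of $\min_{x\in\mathbb{R}^q} g(x)+f(Kx)$ is nonempty, and there is $\tilde x\in \mathrm{ri}(\mathrm{dom}(g))$ with $K\tilde x\in \mathrm{ri}(\mathrm{dom}(f))$ (ri denotes relative interior, dom the effective domain). The solution set of the saddle point problem is $\Omega=\{(\bar x,\bar y)\in\mathbb{R}^q\times\mathbb{R}^p: 0\in\partial g(\bar x)+K^\top\bar y,\ 0\in\partial f^*(\bar y)-K\bar x\}$. For $\lambda>0$ and closed proper convex $h$, $\mathrm{Prox}_{\lambda h}(x)=\arg\min_y\{h(y)+\frac{1}{2\lambda}\|y-x\|^2\}$.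 Let $\phi=\frac{\sqrt5+1}{2}$. Algorithm GRPDA-L. Choose $x_0=z_0\in\mathbb{R}^q$, $y_0\in\mathbb{R}^p$, $\psi\in(1,\phi)$, $\sigma\in(0,1)$, $\beta>0$, $\mu\in(0,1)$, $\tau_0>0$; set $\varphi=\frac{1+\psi}{\psi^2}\in(1,2)$. For $n=1,2,\ldots$: (1) $z_n=\frac{\psi-1}{\psi}x_{n-1}+\frac1\psi z_{n-1}$ and $x_n=\mathrm{Prox}_{\tau_{n-1}g}(z_n-\tau_{n-1}K^\top y_{n-1})$; (2) (linesearch) $y_n=\mathrm{Prox}_{\beta\tau_n f^*}(y_{n-1}+\beta\tau_n Kx_n)$, where $\tau_n=\varphi\tau_{n-1}\mu^i$ and $i$ is the smallest nonnegative integer such that, with this $\tau_n$ and the corresponding $y_n$, $\sqrt{\beta\tau_n}\,\|K^\top y_n-K^\top y_{n-1}\|\le\sigma\sqrt{\psi/\tau_{n-1}}\,\|y_n-y_{n-1}\|$. (Such an $i$ always exists.) *)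

theory Defs
  imports "HOL-Analysis.Analysis"
begin

section \<open>Extended-real-valued convex functions\<close>

definition eff_dom :: "('a \<Rightarrow> ereal) \<Rightarrow> 'a set"
  where "eff_dom h = {x. h x < \<infinity>}"

text \<open>The library's \<open>epigraph\<close> is for real-valued functions only; as there, the second component
  ranges over the (finite) reals.\<close>

definition ereal_epigraph :: "('a \<Rightarrow> ereal) \<Rightarrow> ('a \<times> real) set"
  where "ereal_epigraph h = {(x, r). h x \<le> ereal r}"

definition closed_proper_convex :: "('a::euclidean_space \<Rightarrow> ereal) \<Rightarrow> bool"
  where "closed_proper_convex h \<longleftrightarrow>
    closed (ereal_epigraph h) \<and>
    (\<forall>x. h x \<noteq> -\<infinity>) \<and> (\<exists>x. h x \<noteq> \<infinity>) \<and>
    convex (ereal_epigraph h)"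

definition fenchel_conjugate :: "('a::euclidean_space \<Rightarrow> ereal) \<Rightarrow> 'a \<Rightarrow> ereal"
  where "fenchel_conjugate h y = (SUP x. ereal (y \<bullet> x) - h x)"

definition subdifferential :: "('a::euclidean_space \<Rightarrow> ereal) \<Rightarrow> 'a \<Rightarrow> 'a set"
  where "subdifferential h x = {v. \<forall>u. h u \<ge> h x + ereal (v \<bullet> (u - x))}"

text \<open>For \<open>lam > 0\<close> and closed proper convex \<open>h\<close> the minimizer exists and is unique, so the choice
  made by \<open>ARG_MIN\<close> is immaterial.\<close>

definition prox :: "real \<Rightarrow> ('a::euclidean_space \<Rightarrow> ereal) \<Rightarrow> 'a \<Rightarrow> 'a"
  where "prox lam h x = (ARG_MIN (\<lambda>u. h u + ereal (1 / (2 * lam) * (norm (u - x))\<^sup>2)) u. True)"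

section \<open>The saddle point problem\<close>

text \<open>The matrix \<open>K\<close> has rows indexed by \<open>'p\<close> and columns by \<open>'q\<close>, so \<open>K *v x\<close> is a vector
  in \<open>real ^ 'p\<close> for \<open>x\<close> in \<open>real ^ 'q\<close>, and the adjoint of \<open>K\<close> is \<open>transpose K\<close>.\<close>

definition primal_minimizers ::
    "(real^'q \<Rightarrow> ereal) \<Rightarrow> (real^'p \<Rightarrow> ereal) \<Rightarrow> real^'q^'p \<Rightarrow> (real^'q) set"
  where "primal_minimizers g f K =
    {x. is_arg_min (\<lambda>x. g x + f (K *v x)) (\<lambda>_. True) x}"

definition saddle_solutions ::
    "(real^'q \<Rightarrow> ereal) \<Rightarrow> (real^'p \<Rightarrow> ereal) \<Rightarrow> real^'q^'p \<Rightarrow> ((real^'q) \<times> (real^'p)) set"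
  where "saddle_solutions g f K =
    {(x, y). 0 \<in> (\<lambda>u. u + transpose K *v y) ` subdifferential g x \<and>
             0 \<in> (\<lambda>v. v - K *v x) ` subdifferential (fenchel_conjugate f) y}"

section \<open>The algorithm GRPDA-L\<close>

definition dual_step ::
    "(real^'p \<Rightarrow> ereal) \<Rightarrow> real^'q^'p \<Rightarrow> real \<Rightarrow> real \<Rightarrow> real^'q \<Rightarrow> real^'p \<Rightarrow> real^'p"
  where "dual_step f K \<beta> t x y =
    prox (\<beta> * t) (fenchel_conjugate f) (y + (\<beta> * t) *\<^sub>R (K *v x))"

text \<open>\<open>s\<close> is the previous step size, \<open>t\<close> the trial one; \<open>x\<close> is the new primal iterate, \<open>y\<close> the old
  dual one.\<close>

definition linesearch_ok ::
    "(real^'p \<Rightarrow> ereal) \<Rightarrow> real^'q^'p \<Rightarrow> real \<Rightarrow> real \<Rightarrow> real \<Rightarrow> real \<Rightarrow> real \<Rightarrow>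
      real^'q \<Rightarrow> real^'p \<Rightarrow> bool"
  where "linesearch_ok f K \<psi> \<sigma> \<beta> s t x y \<longleftrightarrow>
    (let y' = dual_step f K \<beta> t x y in
      sqrt (\<beta> * t) * norm (transpose K *v y' - transpose K *v y)
        \<le> \<sigma> * sqrt (\<psi> / s) * norm (y' - y))"

text \<open>Some trial exponent always passes the test, so \<open>LEAST\<close> denotes the smallest such one.\<close>

definition grpda_l ::
    "(real^'q \<Rightarrow> ereal) \<Rightarrow> (real^'p \<Rightarrow> ereal) \<Rightarrow> real^'q^'p \<Rightarrow>
      real \<Rightarrow> real \<Rightarrow> real \<Rightarrow> real \<Rightarrow>
      (nat \<Rightarrow> real^'q) \<Rightarrow> (nat \<Rightarrow> real^'q) \<Rightarrow> (nat \<Rightarrow> real^'p) \<Rightarrow> (nat \<Rightarrow> real) \<Rightarrow> bool"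
  where "grpda_l g f K \<psi> \<sigma> \<beta> \<mu> z x y \<tau> \<longleftrightarrow>
    x 0 = z 0 \<and>
    (\<forall>n\<ge>1.
      z n = ((\<psi> - 1) / \<psi>) *\<^sub>R x (n - 1) + (1 / \<psi>) *\<^sub>R z (n - 1) \<and>
      x n = prox (\<tau> (n - 1)) g (z n - \<tau> (n - 1) *\<^sub>R (transpose K *v y (n - 1))) \<and>
      (let trial = (\<lambda>i::nat. (1 + \<psi>) / \<psi>\<^sup>2 * \<tau> (n - 1) * \<mu> ^ i) in
        \<tau> n = trial (LEAST i.
          linesearch_ok f K \<psi> \<sigma> \<beta> (\<tau> (n - 1)) (trial i) (x n) (y (n - 1)))) \<and>
      y n = dual_step f K \<beta> (\<tau> n) (x n) (y (n - 1)))"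

end

theory Submission
  imports Defs
begin

text \<open>Under the relative interior condition a primal minimizer has a dual multiplier, so saddle points
  exist. Adding the optimality conditions of two consecutive primal steps and one dual step, tested
  against a saddle point \<open>(x', y')\<close>, shows that
  \<open>\<psi> / (\<psi> - 1) * \<parallel>z\<^sub>n\<^sub>+\<^sub>2 - x'\<parallel>\<^sup>2 + \<parallel>y\<^sub>n - y'\<parallel>\<^sup>2 / \<beta>\<close> decreases, by an amount controlling the residuals
  multiplied by the step ratio \<open>\<tau>\<^sub>n\<^sub>+\<^sub>1 / \<tau>\<^sub>n\<close>. The step sizes themselves need not be bounded below; but
  either \<open>\<tau>\<^sub>n\<^sub>+\<^sub>1 = \<phi> \<tau>\<^sub>n\<close> with \<open>\<phi> > 1\<close> or \<open>\<tau>\<^sub>n\<^sub>+\<^sub>1 \<tau>\<^sub>n\<close> is bounded below, and this forces infinitely many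
  indices at which both the step and the step ratio are bounded below. A cluster point along those
  indices is a saddle point, and monotonicity of the energy centred at it gives convergence of the
  whole sequence.\<close>

section \<open>Subdifferentials, proximal points and conjugates\<close>

text \<open>\<open>subdifferential\<close> itself does not ask for a finite value at
  \<open>a\<close>. The inequality tested at a point of the domain excludes
  \<open>\<infinity>\<close>, and properness excludes \<open>-\<infinity>\<close>.\<close>

lemma subdifferential_finite:
  assumes "closed_proper_convex h" "v \<in> subdifferential h a"
  shows "\<bar>h a\<bar> \<noteq> \<infinity>"
proof -
  obtain b where "h b \<noteq> \<infinity>" and "h a \<noteq> -\<infinity>"
    using assms(1) unfolding closed_proper_convex_def by blast
  moreover have "h a + ereal (v \<bullet> (b - a)) \<le> h b"
    using assms(2) by (simp add: subdifferential_def)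
  ultimately show ?thesis by (cases "h a") auto
qed

lemma subdifferential_real_ineq:
  assumes "v \<in> subdifferential h a" "\<bar>h a\<bar> \<noteq> \<infinity>" "\<bar>h b\<bar> \<noteq> \<infinity>"
  shows "real_of_ereal (h a) + v \<bullet> (b - a) \<le> real_of_ereal (h b)"
proof -
  have "h a + ereal (v \<bullet> (b - a)) \<le> h b"
    using assms(1) by (simp add: subdifferential_def)
  with assms(2,3) show ?thesis by (cases "h a"; cases "h b") auto
qed

lemma subdifferentialI_real:
  assumes "\<And>u r. h u = ereal r \<Longrightarrow> c + v \<bullet> (u - a) \<le> r" "h a = ereal c" "\<And>u. h u \<noteq> -\<infinity>"
  shows "v \<in> subdifferential h a"
  unfolding subdifferential_def
proof (clarify)
  fix u show "h a + ereal (v \<bullet> (u - a)) \<le> h u"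
    using assms(1)[of u] assms(2) assms(3)[of u] by (cases "h u") auto
qed

text \<open>For fixed \<open>u\<close> the subgradient inequality places
  \<open>(a n, r - v n \<bullet> (u - a n))\<close> in the epigraph, and the epigraph is closed.
  Closedness of \<open>h\<close> thus replaces continuity in the limit.\<close>

lemma subdifferential_closed_graph:
  fixes h :: "'a::euclidean_space \<Rightarrow> ereal"
  assumes h: "closed_proper_convex h"
    and sub: "\<And>n. v n \<in> subdifferential h (a n)"
    and lim: "a \<longlonglongrightarrow> a'" "v \<longlonglongrightarrow> v'"
  shows "v' \<in> subdifferential h a'"
proof -
  have cl: "closed (ereal_epigraph h)"
    using h unfolding closed_proper_convex_def by blast
  have key: "h a' \<le> ereal (r - v' \<bullet> (u - a'))" if "h u = ereal r" for u r
  proof -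
    have "(a n, r - v n \<bullet> (u - a n)) \<in> ereal_epigraph h" for n
    proof -
      have "\<bar>h (a n)\<bar> \<noteq> \<infinity>" by (rule subdifferential_finite[OF h sub])
      then show ?thesis
        using subdifferential_real_ineq[OF sub[of n], of u] that
        by (cases "h (a n)") (auto simp: ereal_epigraph_def)
    qed
    moreover have "(\<lambda>n. (a n, r - v n \<bullet> (u - a n))) \<longlonglongrightarrow> (a', r - v' \<bullet> (u - a'))"
      by (intro tendsto_intros lim)
    ultimately have "(a', r - v' \<bullet> (u - a')) \<in> ereal_epigraph h"
      by (rule closed_sequentially[OF cl])
    then show ?thesis by (simp add: ereal_epigraph_def)
  qed
  obtain b where "h b \<noteq> \<infinity>" and ninf: "\<And>u. h u \<noteq> -\<infinity>"
    using h unfolding closed_proper_convex_def by blast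
  then obtain rb where "h b = ereal rb" by (cases "h b") auto
  then have "h a' \<noteq> \<infinity>" using key by force
  then obtain c where c: "h a' = ereal c" using ninf by (cases "h a'") auto
  show ?thesis
    using key c ninf by (intro subdifferentialI_real[of h c]) (auto simp: algebra_simps)
qed

section \<open>Proximal points: existence and optimality condition\<close>

text \<open>The subgradient \<open>w\<close> gives an affine minorant of \<open>h\<close>, which the
  quadratic term outgrows. Since \<open>h\<close> may be discontinuous, the minimum is taken over a
  compact piece \<open>S\<close> of the epigraph, on which the objective \<open>F\<close> is
  continuous.\<close>

lemma prox_is_arg_min:
  fixes h :: "'a::euclidean_space \<Rightarrow> ereal"
  assumes h: "closed_proper_convex h" and lam: "0 < lam"
    and minorant: "w \<in> subdifferential h a"
  shows "is_arg_min (\<lambda>u. h u + ereal (1 / (2 * lam) * (norm (u - x))\<^sup>2)) (\<lambda>_. True) (prox lam h x)"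
proof -
  have ninf: "\<And>u. h u \<noteq> -\<infinity>" and cl: "closed (ereal_epigraph h)"
    using h unfolding closed_proper_convex_def by blast+
  obtain c where c: "h a = ereal c"
    using subdifferential_finite[OF h minorant] by (cases "h a") auto
  have minor: "c + w \<bullet> (u - a) \<le> r" if "h u \<le> ereal r" for u r
    using subdifferential_real_ineq[OF minorant, of u] c that ninf[of u] by (cases "h u") auto
  define q where "q u = 1 / (2 * lam) * (norm (u - x))\<^sup>2" for u
  define F where "F = (\<lambda>p::'a \<times> real. snd p + q (fst p))"
  define C where "C = c + q a"
  define S where "S = ereal_epigraph h \<inter> {p. F p \<le> C}"
  have contF: "continuous_on T F" for T
    unfolding F_def q_def by (intro continuous_intros)
  have "closed S"
    unfolding S_def by (intro closed_Int cl closed_Collect_le contF continuous_on_const)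
  moreover have "bounded S"
  proof -
    define D where "D = C - c - w \<bullet> (x - a)"
    \<comment> \<open>If \<open>s\<close> is the distance to \<open>x\<close>, minorant and level
      bound give \<open>s\<^sup>2 \<le> 2 * lam * (\<bar>D\<bar> + norm w * s)\<close>. For
      \<open>s > 1\<close> the right side is at most a constant times \<open>s\<close>, and that
      constant is below \<open>R\<close>; the final \<open>+ 1\<close> covers
      \<open>s \<le> 1\<close>.\<close>
    define R where "R = 2 * lam * (norm w + \<bar>D\<bar> + 1) + 1"
    have R: "norm (u - x) \<le> R \<and> \<bar>r\<bar> \<le> \<bar>C\<bar> + \<bar>c\<bar> + norm w * (R + norm (x - a))"
      if "(u, r) \<in> S" for u r
    proof -
      have hr: "h u \<le> ereal r" and Fr: "r + q u \<le> C"
        using that by (auto simp: S_def ereal_epigraph_def F_def)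
      have m: "c + w \<bullet> (u - a) \<le> r" using minor[OF hr] .
      define s where "s = norm (u - x)"
      have s0: "0 \<le> s" by (simp add: s_def)
      have split: "w \<bullet> (u - a) = w \<bullet> (u - x) + w \<bullet> (x - a)" by (simp add: algebra_simps)
      have cs: "\<bar>w \<bullet> (u - x)\<bar> \<le> norm w * s"
        unfolding s_def by (rule Cauchy_Schwarz_ineq2)
      have cs2: "\<bar>w \<bullet> (x - a)\<bar> \<le> norm w * norm (x - a)"
        by (rule Cauchy_Schwarz_ineq2)
      have "q u \<le> D + norm w * s"
        using m Fr split cs unfolding D_def by linarith
      then have "s\<^sup>2 \<le> 2 * lam * (D + norm w * s)"
        using lam by (simp add: q_def s_def field_simps)
      also have "\<dots> \<le> 2 * lam * (\<bar>D\<bar> + norm w * s)" using lam by simp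
      finally have sq: "s\<^sup>2 \<le> 2 * lam * (\<bar>D\<bar> + norm w * s)" .
      have sR: "s \<le> R"
      proof (cases "s \<le> 1")
        case True
        then show ?thesis using lam by (simp add: R_def add.commute add_increasing2)
      next
        case False
        have "\<bar>D\<bar> * 1 \<le> \<bar>D\<bar> * s" using False by (intro mult_left_mono) auto
        then have "2 * lam * (\<bar>D\<bar> + norm w * s) \<le> 2 * lam * (\<bar>D\<bar> * s + norm w * s)"
          using lam by (intro mult_left_mono) auto
        then have "s * s \<le> (2 * lam * (\<bar>D\<bar> + norm w)) * s"
          using sq by (simp add: power2_eq_square algebra_simps)
        then have "s \<le> 2 * lam * (\<bar>D\<bar> + norm w)" using False by simp
        then show ?thesis using lam unfolding R_def by (simp add: algebra_simps)
      qed
      have "norm w * s \<le> norm w * R" using sR by (simp add: mult_left_mono)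
      moreover have "0 \<le> q u" using lam by (simp add: q_def)
      ultimately have "\<bar>r\<bar> \<le> \<bar>C\<bar> + \<bar>c\<bar> + norm w * (R + norm (x - a))"
        using m Fr split cs cs2 by (simp only: distrib_left)
      then show ?thesis using sR s_def by blast
    qed
    have "S \<subseteq> cball x R \<times> cball 0 (\<bar>C\<bar> + \<bar>c\<bar> + norm w * (R + norm (x - a)))"
      using R by (auto simp: dist_norm norm_minus_commute)
    then show ?thesis by (rule bounded_subset[rotated]) (intro bounded_Times bounded_cball)
  qed
  ultimately have "compact S" by (simp add: compact_eq_bounded_closed)
  moreover have "(a, c) \<in> S" by (simp add: S_def C_def ereal_epigraph_def c F_def)
  ultimately obtain p where p: "p \<in> S" "\<And>p'. p' \<in> S \<Longrightarrow> F p \<le> F p'"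
    using continuous_attains_inf[OF _ _ contF, of S] by blast
  obtain u0 r0 where ur: "p = (u0, r0)" by (cases p)
  \<comment> \<open>Outside \<open>S\<close> the objective exceeds the level \<open>C\<close>, so
    the minimum over \<open>S\<close> is global.\<close>
  have opt: "F p \<le> r + q u" if "h u = ereal r" for u r
  proof (cases "r + q u \<le> C")
    case True
    then have "(u, r) \<in> S" using that by (simp add: S_def ereal_epigraph_def F_def)
    then show ?thesis using p(2)[of "(u, r)"] by (simp add: F_def)
  next
    case False
    then show ?thesis using p(1) by (simp add: S_def)
  qed
  have "is_arg_min (\<lambda>u. h u + ereal (q u)) (\<lambda>_. True) u0"
    unfolding is_arg_min_linorder
  proof (intro conjI TrueI allI impI)
    fix u
    have "h u0 + ereal (q u0) \<le> ereal (F p)"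
      using p(1) by (cases "h u0") (auto simp: S_def ur ereal_epigraph_def F_def)
    also have "\<dots> \<le> h u + ereal (q u)"
      using opt[of u] ninf[of u] by (cases "h u") auto
    finally show "h u0 + ereal (q u0) \<le> h u + ereal (q u)" .
  qed
  then show ?thesis
    unfolding prox_def arg_min_def q_def by (rule someI)
qed

text \<open>Fermat's rule: compare the minimizer with a point at fraction \<open>t\<close> of the
  segment to \<open>u\<close>, bound \<open>h\<close> there by convexity, divide by \<open>t\<close>
  and let \<open>t\<close> fall to \<open>0\<close>. The second-order part of the quadratic term
  disappears in the limit.\<close>

lemma prox_subdifferential:
  fixes h :: "'a::euclidean_space \<Rightarrow> ereal"
  assumes h: "closed_proper_convex h" and lam: "0 < lam"
    and minorant: "w \<in> subdifferential h a"
  shows "(1 / lam) *\<^sub>R (x - prox lam h x) \<in> subdifferential h (prox lam h x)"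
proof -
  define p where "p = prox lam h x"
  define q where "q u = 1 / (2 * lam) * (norm (u - x))\<^sup>2" for u
  have ninf: "\<And>u. h u \<noteq> -\<infinity>" and cv: "convex (ereal_epigraph h)"
    using h unfolding closed_proper_convex_def by blast+
  have opt: "h p + ereal (q p) \<le> h u + ereal (q u)" for u
    using prox_is_arg_min[OF assms, of x] unfolding is_arg_min_linorder p_def q_def by blast
  obtain c where c: "h a = ereal c"
    using subdifferential_finite[OF h minorant] by (cases "h a") auto
  obtain hp where hp: "h p = ereal hp"
    using opt[of a] c ninf[of p] by (cases "h p") auto
  have "(1 / lam) *\<^sub>R (x - p) \<in> subdifferential h p"
  proof (rule subdifferentialI_real[where c = hp])
    fix u r assume r: "h u = ereal r"
    define d where "d = u - p"
    have ineq: "hp - r - (1 / lam) * ((p - x) \<bullet> d) \<le> t * ((1 / (2 * lam)) * (norm d)\<^sup>2)"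
      if t: "0 < t" "t \<le> 1" for t
    proof -
      have "(1 - t) *\<^sub>R (p, hp) + t *\<^sub>R (u, r) \<in> ereal_epigraph h"
        using t hp r by (intro convexD[OF cv]) (auto simp: ereal_epigraph_def)
      moreover have "(1 - t) *\<^sub>R (p, hp) + t *\<^sub>R (u, r) = (p + t *\<^sub>R d, hp + t * (r - hp))"
        by (simp add: d_def algebra_simps)
      ultimately have "h (p + t *\<^sub>R d) \<le> ereal (hp + t * (r - hp))"
        by (simp add: ereal_epigraph_def)
      then have "hp + q p \<le> hp + t * (r - hp) + q (p + t *\<^sub>R d)"
        using opt[of "p + t *\<^sub>R d"] hp by (cases "h (p + t *\<^sub>R d)") auto
      moreover have "q (p + t *\<^sub>R d)
          = q p + t * ((1 / lam) * ((p - x) \<bullet> d)) + t * (t * ((1 / (2 * lam)) * (norm d)\<^sup>2))"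
      proof -
        have "(norm (p + t *\<^sub>R d - x))\<^sup>2
            = (norm (p - x))\<^sup>2 + 2 * t * ((p - x) \<bullet> d) + t * (t * (norm d)\<^sup>2)"
          unfolding power2_norm_eq_inner by (simp add: algebra_simps inner_commute)
        then show ?thesis using lam by (simp add: q_def field_simps)
      qed
      ultimately have "t * (hp - r - (1 / lam) * ((p - x) \<bullet> d)) \<le> t * (t * ((1 / (2 * lam)) * (norm d)\<^sup>2))"
        by (simp add: right_diff_distrib distrib_left)
      then show ?thesis using t(1) by (simp only: mult_le_cancel_left_pos)
    qed
    define c where "c = hp - r - (1 / lam) * ((p - x) \<bullet> d)"
    define e where "e = (1 / (2 * lam)) * (norm d)\<^sup>2"
    have "((\<lambda>t. t * e) \<longlongrightarrow> 0 * e) (at_right 0)"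
      by (intro tendsto_intros)
    moreover have "eventually (\<lambda>t. c \<le> t * e) (at_right 0)"
      unfolding eventually_at_right_field
      by (intro exI[of _ 1]) (use ineq in \<open>auto simp: c_def e_def simp del: times_divide_eq_left times_divide_eq_right\<close>)
    ultimately have "c \<le> 0 * e"
      by (rule tendsto_lowerbound) simp
    then have "hp - r - (1 / lam) * ((p - x) \<bullet> d) \<le> 0"
      by (simp add: c_def)
    moreover have "(1 / lam) *\<^sub>R (x - p) \<bullet> (u - p) = - ((1 / lam) * ((p - x) \<bullet> d))"
      by (simp add: d_def inner_diff_left right_diff_distrib)
    ultimately show "hp + (1 / lam) *\<^sub>R (x - p) \<bullet> (u - p) \<le> r" by linarith
  qed (use hp ninf in auto)
  then show ?thesis by (simp add: p_def)
qed

section \<open>Conjugates and inversion of subgradients\<close>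

lemma fenchel_conjugate_ge: "ereal (y \<bullet> x) - h x \<le> fenchel_conjugate h y"
  unfolding fenchel_conjugate_def by (rule SUP_upper) simp

text \<open>Equality case of the Fenchel-Young inequality: the subgradient inequality says that the
  supremum defining the conjugate is attained at \<open>x\<close>.\<close>

lemma fenchel_conjugate_eq_on_subdifferential:
  assumes "y \<in> subdifferential h x" "h x = ereal c"
  shows "fenchel_conjugate h y = ereal (y \<bullet> x - c)"
proof (rule antisym)
  show "ereal (y \<bullet> x - c) \<le> fenchel_conjugate h y"
    using fenchel_conjugate_ge[of y x h] assms(2) by simp
  show "fenchel_conjugate h y \<le> ereal (y \<bullet> x - c)"
    unfolding fenchel_conjugate_def
  proof (rule SUP_least)
    fix u
    have "h x + ereal (y \<bullet> (u - x)) \<le> h u" using assms(1) by (simp add: subdifferential_def)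
    then show "ereal (y \<bullet> u) - h u \<le> ereal (y \<bullet> x - c)"
      using assms(2) by (cases "h u") (auto simp: inner_diff_right)
  qed
qed

text \<open>The affine function \<open>u \<mapsto> u \<bullet> x - h x\<close> has slope
  \<open>x\<close>, lies below the conjugate, and touches it at \<open>y\<close> by the equality
  case.\<close>

lemma subdifferential_fenchel_conjugate:
  assumes h: "closed_proper_convex h" and y: "y \<in> subdifferential h x"
  shows "x \<in> subdifferential (fenchel_conjugate h) y"
proof -
  obtain c where c: "h x = ereal c"
    using subdifferential_finite[OF h y] by (cases "h x") auto
  show ?thesis
    unfolding subdifferential_def
  proof clarify
    fix u
    have "fenchel_conjugate h y + ereal (x \<bullet> (u - y)) = ereal (u \<bullet> x) - h x"
      using fenchel_conjugate_eq_on_subdifferential[OF y c] c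
      by (simp add: inner_diff_right inner_commute)
    then show "fenchel_conjugate h y + ereal (x \<bullet> (u - y)) \<le> fenchel_conjugate h u"
      using fenchel_conjugate_ge[of u x h] by simp
  qed
qed

text \<open>Each \<open>x\<close> of the domain contributes one half-space, and points of value
  \<open>\<infinity>\<close> impose no constraint. Closedness and convexity of the conjugate can be
  read off this form.\<close>

lemma ereal_epigraph_fenchel_conjugate:
  assumes "\<And>x. h x \<noteq> -\<infinity>"
  shows "ereal_epigraph (fenchel_conjugate h)
    = (\<Inter>x \<in> eff_dom h. {p. (x, -1) \<bullet> p \<le> real_of_ereal (h x)})"
proof -
  have "ereal (y \<bullet> x) - h x \<le> ereal r \<longleftrightarrow> (x \<in> eff_dom h \<longrightarrow> x \<bullet> y - r \<le> real_of_ereal (h x))" for x y r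
    using assms[of x] by (cases "h x") (auto simp: eff_dom_def inner_commute algebra_simps)
  then show ?thesis
    by (auto simp: ereal_epigraph_def fenchel_conjugate_def SUP_le_iff)
qed

text \<open>The pair \<open>(x, y)\<close> serves properness: \<open>h x\<close> is finite, which
  keeps the conjugate above \<open>-\<infinity>\<close> everywhere, and the equality case makes it
  finite at \<open>y\<close>.\<close>

lemma closed_proper_convex_fenchel_conjugate:
  assumes h: "closed_proper_convex h" and y: "y \<in> subdifferential h x"
  shows "closed_proper_convex (fenchel_conjugate h)"
proof -
  have ninf: "\<And>x. h x \<noteq> -\<infinity>" using h unfolding closed_proper_convex_def by blast
  obtain c where c: "h x = ereal c"
    using subdifferential_finite[OF h y] by (cases "h x") auto
  have "fenchel_conjugate h u \<noteq> -\<infinity>" for u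
    using fenchel_conjugate_ge[of u x h] c by auto
  moreover have "fenchel_conjugate h y \<noteq> \<infinity>"
    using fenchel_conjugate_eq_on_subdifferential[OF y c] by simp
  moreover have "closed (ereal_epigraph (fenchel_conjugate h))"
    unfolding ereal_epigraph_fenchel_conjugate[OF ninf]
    by (intro closed_INT ballI closed_halfspace_le)
  moreover have "convex (ereal_epigraph (fenchel_conjugate h))"
    unfolding ereal_epigraph_fenchel_conjugate[OF ninf]
    by (intro convex_INT convex_halfspace_le)
  ultimately show ?thesis unfolding closed_proper_convex_def by blast
qed

section \<open>Existence of saddle points\<close>

lemma matrix_inner_transpose:
  fixes K :: "real^'q^'p"
  shows "(K *v x) \<bullet> y = x \<bullet> (transpose K *v y)"
  by (metis dot_lmul_matrix inner_commute transpose_matrix_vector)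

text \<open>The domain is the linear projection of the epigraph.\<close>

lemma convex_eff_dom:
  assumes "convex (ereal_epigraph h)"
  shows "convex (eff_dom h)"
proof -
  have "x \<in> fst ` ereal_epigraph h" if x: "h x < \<infinity>" for x
  proof -
    obtain r where "h x \<le> ereal r" using x by (cases "h x") auto
    then have "(x, r) \<in> ereal_epigraph h" by (simp add: ereal_epigraph_def)
    then show ?thesis by force
  qed
  moreover have "h x < \<infinity>" if "x \<in> fst ` ereal_epigraph h" for x
    using that by (auto simp: ereal_epigraph_def intro: le_less_trans)
  ultimately have "eff_dom h = fst ` ereal_epigraph h"
    by (auto simp: eff_dom_def)
  with assms show ?thesis by (simp add: convex_linear_image linear_fst)
qed

text \<open>The segment from \<open>u\<close> to the relative interior point \<open>0\<close> can be
  prolonged inside \<open>U\<close>, and there the functional has the opposite sign.\<close>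

lemma convex_ge_at_rel_interior_imp_const:
  fixes U :: "'a::euclidean_space set"
  assumes "convex U" "0 \<in> rel_interior U" "\<And>u. u \<in> U \<Longrightarrow> 0 \<le> a \<bullet> u" "u \<in> U"
  shows "a \<bullet> u = 0"
proof -
  obtain e where e: "1 < e" "(1 - e) *\<^sub>R u + e *\<^sub>R 0 \<in> U"
    using convex_rel_interior_if2[OF assms(1,2)] assms(4) hull_inc by metis
  then have "0 \<le> (1 - e) * (a \<bullet> u)" using assms(3)[OF e(2)] by simp
  then have "a \<bullet> u \<le> 0" using e(1) by (simp add: zero_le_mult_iff)
  with assms(3,4) show ?thesis by force
qed

text \<open>The multiplier is the slope at \<open>0\<close> of a hyperplane supporting the epigraph of the
  perturbation function \<open>u \<mapsto> inf\<^sub>x g x + f (K x + u)\<close>; the relative interior condition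
  excludes a vertical one.\<close>

lemma exists_dual_multiplier:
  fixes f :: "real^'p \<Rightarrow> ereal" and g :: "real^'q \<Rightarrow> ereal" and K :: "real^'q^'p"
  assumes f: "closed_proper_convex f" and g: "closed_proper_convex g"
    and xs: "xs \<in> primal_minimizers g f K"
    and ri: "xt \<in> rel_interior (eff_dom g)" "K *v xt \<in> rel_interior (eff_dom f)"
  obtains ys where "- (transpose K *v ys) \<in> subdifferential g xs"
    and "ys \<in> subdifferential f (K *v xs)"
proof -
  have fninf: "\<And>w. f w \<noteq> -\<infinity>" and gninf: "\<And>x. g x \<noteq> -\<infinity>"
    and fcv: "convex (ereal_epigraph f)" and gcv: "convex (ereal_epigraph g)"
    using f g unfolding closed_proper_convex_def by blast+
  have opt: "g xs + f (K *v xs) \<le> g x + f (K *v x)" for x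
    using xs unfolding primal_minimizers_def is_arg_min_linorder by blast
  have "g xt < \<infinity>" "f (K *v xt) < \<infinity>"
    using ri rel_interior_subset by (auto simp: eff_dom_def)
  then have "g xs + f (K *v xs) < \<infinity>"
    using opt[of xt] by (cases "g xt"; cases "f (K *v xt)") auto
  then obtain gs fs where gs: "g xs = ereal gs" and fs: "f (K *v xs) = ereal fs"
    using fninf[of "K *v xs"] gninf[of xs] by (cases "g xs"; cases "f (K *v xs)") auto
  \<comment> \<open>\<open>L\<close> sends epigraph points over \<open>x\<close> and
    \<open>w\<close> to the perturbation \<open>w - K *v x\<close> and the total height.
    \<open>C\<close> is, up to boundary points, the epigraph of the perturbation function lowered by
    the optimal value; \<open>U\<close> is its domain.\<close>
  define L :: "((real^'q) \<times> real) \<times> ((real^'p) \<times> real) \<Rightarrow> (real^'p) \<times> real"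
    where "L = (\<lambda>p. (fst (snd p) - K *v fst (fst p), snd (fst p) + snd (snd p)))"
  define L' :: "(real^'q) \<times> (real^'p) \<Rightarrow> real^'p" where "L' = (\<lambda>p. snd p - K *v fst p)"
  define C where "C = (+) (0, - (gs + fs)) ` L ` (ereal_epigraph g \<times> ereal_epigraph f)"
  define U where "U = L' ` (eff_dom g \<times> eff_dom f)"
  have linL: "linear L"
    unfolding L_def by (rule linearI) (auto simp: algebra_simps matrix_vector_right_distrib matrix_vector_mult_scaleR)
  have linL': "linear L'"
    unfolding L'_def by (rule linearI) (auto simp: algebra_simps matrix_vector_right_distrib matrix_vector_mult_scaleR)
  have cvdom: "convex (eff_dom g)" "convex (eff_dom f)"
    using convex_eff_dom fcv gcv by auto
  have convC: "convex C"
    unfolding C_def by (intro convex_translation convex_linear_image linL convex_Times gcv fcv)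
  have convU: "convex U"
    unfolding U_def by (intro convex_linear_image linL' convex_Times cvdom)
  have memC: "(w - K *v x, r + s - (gs + fs)) \<in> C" if "g x \<le> ereal r" "f w \<le> ereal s" for x w r s
  proof -
    have "((x, r), (w, s)) \<in> ereal_epigraph g \<times> ereal_epigraph f"
      using that by (simp add: ereal_epigraph_def)
    then have "(0, - (gs + fs)) + L ((x, r), (w, s)) \<in> C"
      unfolding C_def by (intro imageI)
    then show ?thesis by (simp add: L_def algebra_simps)
  qed
  have C_nonneg: "0 \<le> t" if "(0, t) \<in> C" for t
  proof -
    have "(0, t) \<in> (\<lambda>q. (0, - (gs + fs)) + L q) ` (ereal_epigraph g \<times> ereal_epigraph f)"
      using that unfolding C_def image_image .
    then obtain q where q: "(0, t) = (0, - (gs + fs)) + L q" "q \<in> ereal_epigraph g \<times> ereal_epigraph f"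
      by (rule imageE)
    obtain x r w s where "q = ((x, r), (w, s))" by (metis prod.exhaust)
    with q have p: "((x, r), (w, s)) \<in> ereal_epigraph g \<times> ereal_epigraph f"
      and "(0, t) = (0, - (gs + fs)) + L ((x, r), (w, s))" by auto
    then have "w = K *v x" "t = r + s - (gs + fs)" by (auto simp: L_def)
    moreover have "g x \<le> ereal r" "f w \<le> ereal s" using p by (auto simp: ereal_epigraph_def)
    ultimately have "g x + f (K *v x) \<le> ereal r + ereal s" by (intro add_mono) auto
    with opt[of x] have "g xs + f (K *v xs) \<le> ereal r + ereal s" by (rule order_trans)
    then have "gs + fs \<le> r + s" by (simp add: gs fs)
    with \<open>t = _\<close> show ?thesis by simp
  qed
  have zero: "0 \<in> C"
    using memC[of xs gs "K *v xs" fs] gs fs by (simp add: zero_prod_def)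
  \<comment> \<open>Otherwise the segment from \<open>(0, 1)\<close> to \<open>0\<close> could be
    prolonged in \<open>C\<close> to a negative height above perturbation \<open>0\<close>, against
    optimality of \<open>xs\<close>.\<close>
  have zero_notin: "0 \<notin> rel_interior C"
  proof
    assume ri0: "0 \<in> rel_interior C"
    have up: "(0, 1) \<in> C"
      using memC[of xs gs "K *v xs" "fs + 1"] gs fs by simp
    obtain e where e: "1 < e" "(1 - e) *\<^sub>R (0, 1) + e *\<^sub>R 0 \<in> C"
      using bspec[OF convex_rel_interior_if2[OF convC ri0] hull_inc[OF up]] by blast
    then show False using C_nonneg[of "1 - e"] by simp
  qed
  obtain n where "n \<noteq> 0" "\<And>p. p \<in> C \<Longrightarrow> n \<bullet> 0 \<le> n \<bullet> p" "\<And>p. p \<in> rel_interior C \<Longrightarrow> n \<bullet> 0 < n \<bullet> p"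
    by (rule supporting_hyperplane_rel_boundary[OF convC zero zero_notin]) blast
  then have n: "\<And>p. p \<in> C \<Longrightarrow> 0 \<le> n \<bullet> p" "\<And>p. p \<in> rel_interior C \<Longrightarrow> 0 < n \<bullet> p"
    by simp_all
  obtain a \<alpha> where na: "n = (a, \<alpha>)" by (cases n)
  have sep: "0 \<le> a \<bullet> (w - K *v x) + \<alpha> * (r + s - (gs + fs))" if "g x \<le> ereal r" "f w \<le> ereal s" for x w r s
    using n(1)[OF memC[OF that]] by (simp add: na)
  have "0 \<le> \<alpha>"
    using sep[of xs gs "K *v xs" "fs + 1"] gs fs by simp
  \<comment> \<open>With a vertical hyperplane, \<open>a\<close> is nonnegative on \<open>U\<close>.
    Relative interiors commute with products and linear images, so \<open>xt\<close> puts
    \<open>0\<close> in the relative interior of \<open>U\<close>; hence \<open>a\<close> vanishes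
    on \<open>U\<close>, against strict positivity of \<open>n\<close> on the relative interior of
    \<open>C\<close>.\<close>
  moreover have "\<alpha> \<noteq> 0"
  proof
    assume \<alpha>: "\<alpha> = 0"
    have "(xt, K *v xt) \<in> rel_interior (eff_dom g \<times> eff_dom f)"
      using ri by (simp add: rel_interior_Times cvdom)
    then have "L' (xt, K *v xt) \<in> rel_interior U"
      unfolding U_def rel_interior_convex_linear_image[OF linL' convex_Times[OF cvdom], symmetric]
      by (rule imageI)
    then have 0: "0 \<in> rel_interior U" by (simp add: L'_def)
    have nonneg: "0 \<le> a \<bullet> u" if u: "u \<in> U" for u
    proof -
      obtain q where q: "u = L' q" "q \<in> eff_dom g \<times> eff_dom f"
        using u unfolding U_def by (rule imageE)
      define x where "x = fst q"
      define w where "w = snd q"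
      have x: "g x < \<infinity>" "f w < \<infinity>" "u = w - K *v x"
        using q by (auto simp: x_def w_def L'_def eff_dom_def mem_Times_iff)
      obtain r where "g x \<le> ereal r" using x(1) by (cases "g x") auto
      moreover obtain s where "f w \<le> ereal s" using x(2) by (cases "f w") auto
      ultimately show ?thesis using sep[of x r w s] x \<alpha> by simp
    qed
    obtain p where p: "p \<in> rel_interior C"
      using rel_interior_eq_empty[OF convC] zero by blast
    then have "p \<in> (\<lambda>q. (0, - (gs + fs)) + L q) ` (ereal_epigraph g \<times> ereal_epigraph f)"
      using rel_interior_subset[of C] unfolding C_def image_image by blast
    then obtain q where q: "p = (0, - (gs + fs)) + L q" "q \<in> ereal_epigraph g \<times> ereal_epigraph f"
      by (rule imageE)
    then have "fst p = L' (fst (fst q), fst (snd q))" by (simp add: L_def L'_def)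
    moreover have "(fst (fst q), fst (snd q)) \<in> eff_dom g \<times> eff_dom f"
      using q(2) by (auto simp: ereal_epigraph_def eff_dom_def intro: le_less_trans)
    ultimately have "fst p \<in> U" unfolding U_def by blast
    then have "a \<bullet> fst p = 0"
      using convex_ge_at_rel_interior_imp_const[OF convU 0 nonneg] by blast
    then show False using n(2)[OF p] by (cases p) (simp add: na \<alpha>)
  qed
  ultimately have \<alpha>: "0 < \<alpha>" by simp
  \<comment> \<open>Dividing by \<open>\<alpha>\<close> turns the normal into a slope:
    \<open>bound\<close> says that \<open>ys\<close> is a subgradient of the perturbation function
    at \<open>0\<close>.\<close>
  define ys where "ys = - (1 / \<alpha>) *\<^sub>R a"
  have a_ys: "a = - \<alpha> *\<^sub>R ys" using \<alpha> by (simp add: ys_def)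
  have bound: "gs + fs + ys \<bullet> (w - K *v x) \<le> r + s" if "g x \<le> ereal r" "f w \<le> ereal s" for x w r s
  proof -
    have "0 \<le> \<alpha> * (r + s - (gs + fs) - ys \<bullet> (w - K *v x))"
      using sep[OF that] unfolding a_ys by (simp add: algebra_simps)
    then show ?thesis using \<alpha> by (simp add: zero_le_mult_iff)
  qed
  \<comment> \<open>The joint inequality separates: \<open>w = K *v xs\<close> leaves the condition
    on \<open>g\<close>, and \<open>x = xs\<close> the one on \<open>f\<close>.\<close>
  show ?thesis
  proof
    show "- (transpose K *v ys) \<in> subdifferential g xs"
    proof (rule subdifferentialI_real[where c = gs])
      fix u r assume "g u = ereal r"
      then have "gs + ys \<bullet> (K *v xs - K *v u) \<le> r"
        using bound[of u r "K *v xs" fs] fs by simp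
      moreover have "ys \<bullet> (K *v xs - K *v u) = - (transpose K *v ys) \<bullet> (u - xs)"
        unfolding inner_commute[of ys] inner_commute[of "- (transpose K *v ys)"]
        by (simp add: inner_diff_left matrix_inner_transpose del: transpose_matrix_vector)
      ultimately show "gs + - (transpose K *v ys) \<bullet> (u - xs) \<le> r" by simp
    qed (use gs gninf in auto)
    show "ys \<in> subdifferential f (K *v xs)"
    proof (rule subdifferentialI_real[where c = fs])
      fix u r assume "f u = ereal r"
      then show "fs + ys \<bullet> (u - K *v xs) \<le> r"
        using bound[of xs gs u r] gs by simp
    qed (use fs fninf in auto)
  qed
qed

section \<open>Energy estimate and step sizes\<close>

lemma inner_diff_polarization:
  fixes a b c :: "'a::real_inner"
  shows "2 * ((a - b) \<bullet> (c - a)) = (norm (b - c))\<^sup>2 - (norm (a - b))\<^sup>2 - (norm (a - c))\<^sup>2"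
  unfolding power2_norm_eq_inner by (simp add: algebra_simps inner_commute)

text \<open>With \<open>d = \<tau>\<^sub>n / \<tau>\<^sub>n\<^sub>-\<^sub>1\<close>, hypothesis \<open>sum\<close> is the sum of the subgradient inequalities of the
  newer primal step and the dual step at the saddle point, of the older primal step at the newer
  iterate (scaled by \<open>d\<close>), and of the saddle point at the iterates; the function values cancel.\<close>

lemma energy_descent:
  fixes xs x1 x2 z1 z2 v0 v1 :: "'a::real_inner" and ys y0 y1 :: "'b::real_inner"
  assumes sum: "0 \<le> (x2 - z1) \<bullet> (xs - x2) + \<psi> * d * ((x1 - z1) \<bullet> (x2 - x1))
        + (1 / \<beta>) * ((y1 - y0) \<bullet> (ys - y1)) + t * ((v0 - v1) \<bullet> (x2 - x1))"
    and z2: "z2 = ((\<psi> - 1) / \<psi>) *\<^sub>R x2 + (1 / \<psi>) *\<^sub>R z1"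
    and ls: "t * norm (v1 - v0) \<le> \<sigma> * sqrt (\<psi> * d) * sqrt (1 / \<beta>) * norm (y1 - y0)"
    and par: "1 < \<psi>" "0 < \<beta>" "0 < d" "\<psi> * d \<le> 1 + 1 / \<psi>" "0 \<le> t" "0 < \<sigma>"
  shows "\<psi> / (\<psi> - 1) * (norm (z2 - xs))\<^sup>2 + (1 / \<beta>) * (norm (y1 - ys))\<^sup>2
      + ((1 - \<sigma>) * (\<psi> * d * (norm (x2 - x1))\<^sup>2 + (1 / \<beta>) * (norm (y1 - y0))\<^sup>2)
        + \<psi> * d * (norm (x1 - z1))\<^sup>2)
    \<le> \<psi> / (\<psi> - 1) * (norm (z1 - xs))\<^sup>2 + (1 / \<beta>) * (norm (y0 - ys))\<^sup>2"
proof -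
  define X where "X = (norm (x2 - x1))\<^sup>2"
  define Y where "Y = (norm (y1 - y0))\<^sup>2"
  define Z where "Z = (norm (x2 - z1))\<^sup>2"
  define P where "P = (norm (x1 - z1))\<^sup>2"
  have e1: "2 * ((x2 - z1) \<bullet> (xs - x2)) = (norm (z1 - xs))\<^sup>2 - Z - (norm (x2 - xs))\<^sup>2"
    unfolding Z_def by (rule inner_diff_polarization)
  have e2: "2 * ((x1 - z1) \<bullet> (x2 - x1)) = Z - P - X"
    using inner_diff_polarization[of x1 z1 x2] unfolding Z_def P_def X_def by (simp add: norm_minus_commute)
  have e3: "2 * ((y1 - y0) \<bullet> (ys - y1)) = (norm (y0 - ys))\<^sup>2 - Y - (norm (y1 - ys))\<^sup>2"
    unfolding Y_def by (rule inner_diff_polarization)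
  \<comment> \<open>Cauchy-Schwarz and the linesearch bound, then
    \<open>2 * p * q \<le> p\<^sup>2 + q\<^sup>2\<close>; as \<open>\<sigma> < 1\<close> in the
    algorithm, a fraction \<open>1 - \<sigma>\<close> of both squares survives.\<close>
  have e4: "2 * (t * ((v0 - v1) \<bullet> (x2 - x1))) \<le> \<sigma> * (\<psi> * d * X + (1 / \<beta>) * Y)"
  proof -
    define p where "p = sqrt (\<psi> * d) * norm (x2 - x1)"
    define q where "q = sqrt (1 / \<beta>) * norm (y1 - y0)"
    have "t * ((v0 - v1) \<bullet> (x2 - x1)) \<le> t * (norm (v1 - v0) * norm (x2 - x1))"
      using par norm_cauchy_schwarz[of "v0 - v1" "x2 - x1"]
      by (intro mult_left_mono) (auto simp: norm_minus_commute)
    also have "\<dots> \<le> \<sigma> * sqrt (\<psi> * d) * sqrt (1 / \<beta>) * norm (y1 - y0) * norm (x2 - x1)"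
      using mult_right_mono[OF ls, of "norm (x2 - x1)"] by (simp add: mult.assoc)
    also have "\<dots> = \<sigma> * (p * q)" by (simp add: p_def q_def)
    finally have "2 * (t * ((v0 - v1) \<bullet> (x2 - x1))) \<le> \<sigma> * (2 * (p * q))" by simp
    also have "\<dots> \<le> \<sigma> * (p\<^sup>2 + q\<^sup>2)"
      using par sum_squares_bound[of p q] by (intro mult_left_mono) (auto simp: mult.assoc)
    also have "p\<^sup>2 = \<psi> * d * X" using par by (simp add: p_def X_def power_mult_distrib)
    also have "q\<^sup>2 = (1 / \<beta>) * Y" using par by (simp add: q_def Y_def power_mult_distrib)
    finally show ?thesis .
  qed
  \<comment> \<open>\<open>z2\<close> is a convex combination of \<open>x2\<close> and
    \<open>z1\<close>; this is the squared-norm identity for such a combination, solved for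
    \<open>x2\<close>. It makes \<open>\<psi> / (\<psi> - 1)\<close> the weight for which the
    \<open>z\<close> terms telescope.\<close>
  have e5: "(norm (x2 - xs))\<^sup>2 = \<psi> / (\<psi> - 1) * (norm (z2 - xs))\<^sup>2
      - (\<psi> / (\<psi> - 1) - 1) * (norm (z1 - xs))\<^sup>2 + 1 / \<psi> * Z"
  proof -
    define a where "a = x2 - xs"
    define b where "b = z1 - xs"
    have z: "z2 - xs = (1 / \<psi>) *\<^sub>R ((\<psi> - 1) *\<^sub>R a + b)"
      using par unfolding z2 a_def b_def by (simp add: scaleR_right_diff_distrib scaleR_right_distrib
        scaleR_left_diff_distrib diff_divide_distrib)
    have Zab: "Z = a \<bullet> a - 2 * (a \<bullet> b) + b \<bullet> b"
      unfolding Z_def power2_norm_eq_inner a_def b_def by (simp add: algebra_simps inner_commute)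
    have "(norm (z2 - xs))\<^sup>2 = (1 / \<psi>)\<^sup>2 * ((\<psi> - 1)\<^sup>2 * (a \<bullet> a) + 2 * (\<psi> - 1) * (a \<bullet> b) + b \<bullet> b)"
      unfolding z power2_norm_eq_inner
      by (simp add: inner_add_left inner_add_right inner_commute power2_eq_square algebra_simps)
    moreover have "(norm (x2 - xs))\<^sup>2 = a \<bullet> a" "(norm (z1 - xs))\<^sup>2 = b \<bullet> b"
      by (simp_all add: a_def b_def power2_norm_eq_inner)
    moreover have "A = \<psi> / (\<psi> - 1) * ((1 / \<psi>)\<^sup>2 * ((\<psi> - 1)\<^sup>2 * A + 2 * (\<psi> - 1) * B + C))
        - (\<psi> / (\<psi> - 1) - 1) * C + 1 / \<psi> * (A - 2 * B + C)" for A B C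
    proof -
      define s where "s = \<psi> - 1"
      have s: "\<psi> = s + 1" "s \<noteq> 0" "s + 1 \<noteq> 0" using par by (auto simp: s_def)
      show ?thesis unfolding s(1) using s(2,3)
        by (simp add: divide_simps) (simp add: power2_eq_square algebra_simps)
    qed
    ultimately show ?thesis unfolding Zab by metis
  qed
  have "0 \<le> 2 * ((x2 - z1) \<bullet> (xs - x2) + \<psi> * d * ((x1 - z1) \<bullet> (x2 - x1))
        + (1 / \<beta>) * ((y1 - y0) \<bullet> (ys - y1)) + t * ((v0 - v1) \<bullet> (x2 - x1)))"
    using sum by simp
  also have "\<dots> = (norm (z1 - xs))\<^sup>2 - Z - (norm (x2 - xs))\<^sup>2 + \<psi> * d * (Z - P - X)
      + (1 / \<beta>) * ((norm (y0 - ys))\<^sup>2 - Y - (norm (y1 - ys))\<^sup>2) + 2 * (t * ((v0 - v1) \<bullet> (x2 - x1)))"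
    unfolding e1[symmetric] e2[symmetric] e3[symmetric] by (simp add: algebra_simps)
  also have "\<dots> \<le> (norm (z1 - xs))\<^sup>2 - Z - (norm (x2 - xs))\<^sup>2 + \<psi> * d * (Z - P - X)
      + (1 / \<beta>) * ((norm (y0 - ys))\<^sup>2 - Y - (norm (y1 - ys))\<^sup>2) + \<sigma> * (\<psi> * d * X + (1 / \<beta>) * Y)"
    using e4 by (rule add_left_mono)
  finally have "0 \<le> \<dots>" .
  \<comment> \<open>The terms \<open>- Z\<close> and \<open>- Z / \<psi>\<close> absorb exactly this
    much, so \<open>Z\<close> drops out.\<close>
  moreover have "\<psi> * d * Z \<le> (1 + 1 / \<psi>) * Z"
    using par(4) by (intro mult_right_mono) (auto simp: Z_def)
  ultimately show ?thesis
    unfolding e5 X_def[symmetric] Y_def[symmetric] P_def[symmetric]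
    by (simp add: algebra_simps diff_divide_distrib)
qed

text \<open>Small consecutive steps only grow, so \<open>c \<le> \<tau> n\<close> infinitely often; if the ratio were below \<open>1/2\<close> at
  all such late indices, each of them would have a predecessor more than twice as large, down to
  index \<open>N\<close>.\<close>

lemma step_ratio_infinitely_often:
  fixes \<tau> :: "nat \<Rightarrow> real"
  assumes pos: "\<And>n. 0 < \<tau> n" and \<phi>: "1 < \<phi>" and c: "0 < c"
    and dich: "\<And>n. \<tau> (Suc n) = \<phi> * \<tau> n \<or> c\<^sup>2 \<le> \<tau> (Suc n) * \<tau> n"
  shows "\<exists>n\<ge>N. c \<le> \<tau> (Suc n) \<and> \<tau> n \<le> 2 * \<tau> (Suc n)"
proof (rule ccontr)
  assume "\<not> ?thesis"
  then have neg: "2 * \<tau> (Suc n) < \<tau> n" if "N \<le> n" "c \<le> \<tau> (Suc n)" for n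
    using that by force
  have frequently: "\<exists>k\<ge>m. c \<le> \<tau> k" for m
  proof (rule ccontr)
    assume "\<not> ?thesis"
    then have small: "\<tau> k < c" if "m \<le> k" for k using that by force
    have grow: "\<tau> (m + k) = \<phi> ^ k * \<tau> m" for k
    proof (induction k)
      case (Suc k)
      have "\<tau> (Suc (m + k)) * \<tau> (m + k) < c * c"
        using small[of "m + k"] small[of "Suc (m + k)"] pos[of "m + k"] pos[of "Suc (m + k)"]
        by (intro mult_strict_mono) auto
      then have "\<tau> (Suc (m + k)) = \<phi> * \<tau> (m + k)"
        using dich[of "m + k"] by (auto simp: power2_eq_square)
      then show ?case using Suc by simp
    qed simp
    obtain k where "c / \<tau> m < \<phi> ^ k" using real_arch_pow[OF \<phi>] by blast
    then have "c < \<tau> (m + k)" using pos[of m] by (simp add: grow pos_divide_less_eq)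
    with small[of "m + k"] show False by simp
  qed
  have backward: "c * 2 ^ k \<le> \<tau> (N + j)" if "c \<le> \<tau> (N + j + k)" for j k
    using that
  proof (induction k arbitrary: j)
    case (Suc k)
    have ind: "c * 2 ^ k \<le> \<tau> (N + Suc j)" using Suc.IH[of "Suc j"] Suc.prems by simp
    \<comment> \<open>The bound carried down the chain stays at least \<open>c\<close>, so
      \<open>neg\<close> applies again one index earlier.\<close>
    have "c * 1 \<le> c * 2 ^ k" using c by (intro mult_left_mono) auto
    then have "2 * \<tau> (Suc (N + j)) < \<tau> (N + j)" using ind neg[of "N + j"] by simp
    then show ?case using ind by simp
  qed simp
  obtain k where k: "\<tau> N / c < 2 ^ k" using real_arch_pow[of 2] by auto
  obtain m where m: "N + k \<le> m" "c \<le> \<tau> m" using frequently by blast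
  then have "c * 2 ^ (m - N) \<le> \<tau> N" using backward[of 0 "m - N"] by simp
  moreover have "c * 2 ^ k \<le> c * 2 ^ (m - N)"
    using m c by (intro mult_left_mono power_increasing) auto
  moreover have "\<tau> N < c * 2 ^ k"
    using k c by (simp add: pos_divide_less_eq mult.commute)
  ultimately show False by linarith
qed

text \<open>A trial step that fails the test, multiplied by \<open>s\<close>, exceeds \<open>\<sigma>\<^sup>2 * \<psi> / (\<beta> * L\<^sup>2)\<close>, and the accepted step
  is \<open>\<mu>\<close> times the last failed one.\<close>

lemma linesearch_step:
  fixes f :: "real^'p \<Rightarrow> ereal" and K :: "real^'q^'p"
  assumes pos: "0 < \<sigma>" "0 < \<psi>" "0 < \<beta>" "0 < \<mu>" "\<mu> < 1" "0 < s" "0 < r"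
    and L: "0 < L" "\<And>u. norm (transpose K *v u) \<le> L * norm u"
    and t: "t = r * \<mu> ^ (LEAST i. linesearch_ok f K \<psi> \<sigma> \<beta> s (r * \<mu> ^ i) x y)"
  shows "0 < t \<and> t \<le> r \<and> linesearch_ok f K \<psi> \<sigma> \<beta> s t x y
    \<and> (t = r \<or> \<mu> * (\<sigma>\<^sup>2 * \<psi> / (\<beta> * L\<^sup>2)) \<le> t * s)"
proof -
  define M where "M = \<sigma>\<^sup>2 * \<psi> / (\<beta> * L\<^sup>2)"
  have M: "0 < M" using pos L by (simp add: M_def)
  have ok: "linesearch_ok f K \<psi> \<sigma> \<beta> s u x y" if u: "0 < u" "u * s \<le> M" for u
  proof -
    define e where "e = dual_step f K \<beta> u x y - y"
    \<comment> \<open>\<open>u * s \<le> M\<close> is the square of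
      \<open>sqrt (\<beta> * u) * L \<le> \<sigma> * sqrt (\<psi> / s)\<close>, so the norm bound on
      the transpose passes the test wherever the trial dual point lies.\<close>
    have "\<beta> * u * L\<^sup>2 \<le> \<sigma>\<^sup>2 * (\<psi> / s)"
      using u(2) pos L by (simp add: M_def field_simps)
    then have "sqrt (\<beta> * u * L\<^sup>2) \<le> sqrt (\<sigma>\<^sup>2 * (\<psi> / s))"
      by (rule real_sqrt_le_mono)
    then have le: "sqrt (\<beta> * u) * L \<le> \<sigma> * sqrt (\<psi> / s)"
      using pos L(1) by (simp add: real_sqrt_mult real_sqrt_divide)
    have "sqrt (\<beta> * u) * norm (transpose K *v e) \<le> sqrt (\<beta> * u) * (L * norm e)"
      using L(2) u(1) pos by (intro mult_left_mono) auto
    also have "\<dots> \<le> \<sigma> * sqrt (\<psi> / s) * norm e"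
      using mult_right_mono[OF le, of "norm e"] by (simp add: mult.assoc)
    finally show ?thesis
      unfolding linesearch_ok_def Let_def e_def by (simp only: matrix_vector_mult_diff_distrib)
  qed
  define P where "P i \<longleftrightarrow> linesearch_ok f K \<psi> \<sigma> \<beta> s (r * \<mu> ^ i) x y" for i
  have small: "P i" if "r * \<mu> ^ i * s \<le> M" for i
    unfolding P_def using pos that by (intro ok) auto
  obtain i where i: "\<mu> ^ i < M / (r * s)"
    using real_arch_pow_inv[of "M / (r * s)" \<mu>] M pos by auto
  have "r * \<mu> ^ i * s \<le> M" using i pos by (simp add: field_simps)
  then have ex: "P i" by (rule small)
  define l where "l = (LEAST i. P i)"
  have Pl: "P l" unfolding l_def using ex by (rule LeastI)
  have tl: "t = r * \<mu> ^ l" unfolding t l_def P_def ..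
  have "t = r \<or> \<mu> * M \<le> t * s"
  proof (cases l)
    case (Suc k)
    then have "\<not> P k" unfolding l_def by (intro not_less_Least) simp
    then have "M < r * \<mu> ^ k * s" using small[of k] by linarith
    then have "\<mu> * M \<le> \<mu> * (r * \<mu> ^ k * s)" using pos by (intro mult_left_mono) auto
    then show ?thesis by (simp add: tl Suc mult_ac)
  qed (simp add: tl)
  moreover have "t \<le> r"
    using pos by (simp add: tl mult_left_le power_le_one)
  ultimately show ?thesis
    using Pl pos by (simp add: tl P_def M_def)
qed

section \<open>Convergence\<close>

lemma zero_in_image_add_iff: "0 \<in> (\<lambda>u. u + a) ` S \<longleftrightarrow> - a \<in> S"
  and zero_in_image_diff_iff: "0 \<in> (\<lambda>u. u - a) ` S \<longleftrightarrow> a \<in> S"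
  for a :: "'a::ab_group_add"
  by (auto simp: image_iff eq_neg_iff_add_eq_0[symmetric] dest: sym)

lemma saddle_solutions_iff:
  "(x, y) \<in> saddle_solutions g f K \<longleftrightarrow>
    - (transpose K *v y) \<in> subdifferential g x \<and> K *v x \<in> subdifferential (fenchel_conjugate f) y"
  by (simp add: saddle_solutions_def zero_in_image_add_iff zero_in_image_diff_iff)

lemma tendsto_zero_norm_square_le:
  fixes a :: "nat \<Rightarrow> 'a::real_normed_vector"
  assumes "\<And>n. (norm (a n))\<^sup>2 \<le> C * e n" "e \<longlonglongrightarrow> 0"
  shows "a \<longlonglongrightarrow> 0"
proof -
  have "(\<lambda>n. C * e n) \<longlonglongrightarrow> C * 0" by (intro tendsto_intros assms)
  then have "(\<lambda>n. (norm (a n))\<^sup>2) \<longlonglongrightarrow> 0"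
    by (intro tendsto_sandwich[of "\<lambda>_. 0" "\<lambda>n. (norm (a n))\<^sup>2" sequentially "\<lambda>n. C * e n"])
       (use assms(1) in auto)
  then have "(\<lambda>n. sqrt ((norm (a n))\<^sup>2)) \<longlonglongrightarrow> sqrt 0" by (rule tendsto_real_sqrt)
  then show ?thesis by (simp add: tendsto_norm_zero_iff)
qed

lemma tendsto_zero_scaleR_bounded:
  fixes a :: "nat \<Rightarrow> 'a::real_normed_vector"
  assumes "a \<longlonglongrightarrow> 0" "\<And>n. \<bar>k n\<bar> \<le> B"
  shows "(\<lambda>n. k n *\<^sub>R a n) \<longlonglongrightarrow> 0"
proof (rule Lim_null_comparison)
  show "eventually (\<lambda>n. norm (k n *\<^sub>R a n) \<le> B * norm (a n)) sequentially"
    using assms(2) by (intro always_eventually allI) (simp add: mult_right_mono)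
  show "(\<lambda>n. B * norm (a n)) \<longlonglongrightarrow> 0"
    using assms(1) by (intro tendsto_mult_right_zero tendsto_norm_zero)
qed

lemma bounded_range_of_weighted_square_le:
  fixes a :: "nat \<Rightarrow> 'a::real_normed_vector"
  assumes "\<And>n. p * (norm (a n - l))\<^sup>2 \<le> M" "0 < p"
  shows "bounded (range a)"
proof -
  have "norm (a n - l) \<le> 1 + M / p" for n
  proof -
    have "(norm (a n - l))\<^sup>2 \<le> M / p" using assms by (simp add: field_simps)
    moreover have "norm (a n - l) \<le> 1 + (norm (a n - l))\<^sup>2"
      using zero_le_power2[of "norm (a n - l) - 1"] norm_ge_zero[of "a n - l"]
      unfolding power2_diff one_power2 mult_1_right by linarith
    ultimately show ?thesis by linarith
  qed
  then show ?thesis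
    by (intro bounded_subset[OF bounded_cball[of l "1 + M / p"]])
       (auto simp: dist_norm norm_minus_commute)
qed

text \<open>A run with one fixed saddle point \<open>(xs, ys)\<close>. That point supplies the
  subgradients which make the proximal points exist, and a first centre for the energy.\<close>

locale grpda_l_run =
  fixes f :: "real^'p \<Rightarrow> ereal" and g :: "real^'q \<Rightarrow> ereal" and K :: "real^'q^'p"
    and \<psi> \<sigma> \<beta> \<mu> :: real
    and z x :: "nat \<Rightarrow> real^'q" and y :: "nat \<Rightarrow> real^'p" and \<tau> :: "nat \<Rightarrow> real"
    and xs :: "real^'q" and ys :: "real^'p"
  assumes f_conj: "closed_proper_convex (fenchel_conjugate f)" and g: "closed_proper_convex g"
    and sol: "(xs, ys) \<in> saddle_solutions g f K"
    and psi: "1 < \<psi>" "\<psi> < (sqrt 5 + 1) / 2"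
    and sigma: "0 < \<sigma>" "\<sigma> < 1" and beta: "0 < \<beta>" and mu: "0 < \<mu>" "\<mu> < 1"
    and tau0: "0 < \<tau> 0"
    and run: "grpda_l g f K \<psi> \<sigma> \<beta> \<mu> z x y \<tau>"
begin

section \<open>Step sizes and optimality conditions along a run\<close>

abbreviation "T u \<equiv> transpose K *v u"
abbreviation "F \<equiv> fenchel_conjugate f"
abbreviation "\<phi> \<equiv> (1 + \<psi>) / \<psi>\<^sup>2"

text \<open>The upper bound on \<open>\<psi>\<close> is the golden ratio, the positive root of
  \<open>t\<^sup>2 = 1 + t\<close>.\<close>

lemma phi_gt_1: "1 < \<phi>"
proof -
  have "2 * \<psi> - 1 < sqrt 5" using psi by simp
  then have "(2 * \<psi> - 1)\<^sup>2 < (sqrt 5)\<^sup>2" using psi by (intro power_strict_mono) auto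
  then have "\<psi>\<^sup>2 < 1 + \<psi>" by (simp add: power2_eq_square algebra_simps)
  then show ?thesis using psi by simp
qed

lemma z_Suc: "z (Suc n) = ((\<psi> - 1) / \<psi>) *\<^sub>R x n + (1 / \<psi>) *\<^sub>R z n"
  and x_Suc: "x (Suc n) = prox (\<tau> n) g (z (Suc n) - \<tau> n *\<^sub>R T (y n))"
  and tau_Suc: "\<tau> (Suc n) = \<phi> * \<tau> n * \<mu> ^ (LEAST i.
      linesearch_ok f K \<psi> \<sigma> \<beta> (\<tau> n) (\<phi> * \<tau> n * \<mu> ^ i) (x (Suc n)) (y n))"
  and y_Suc: "y (Suc n) = dual_step f K \<beta> (\<tau> (Suc n)) (x (Suc n)) (y n)"
proof -
  have "Suc n \<ge> 1" by simp
  then show "z (Suc n) = ((\<psi> - 1) / \<psi>) *\<^sub>R x n + (1 / \<psi>) *\<^sub>R z n"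
    "x (Suc n) = prox (\<tau> n) g (z (Suc n) - \<tau> n *\<^sub>R T (y n))"
    "\<tau> (Suc n) = \<phi> * \<tau> n * \<mu> ^ (LEAST i.
      linesearch_ok f K \<psi> \<sigma> \<beta> (\<tau> n) (\<phi> * \<tau> n * \<mu> ^ i) (x (Suc n)) (y n))"
    "y (Suc n) = dual_step f K \<beta> (\<tau> (Suc n)) (x (Suc n)) (y n)"
    using run unfolding grpda_l_def Let_def by (metis diff_Suc_1)+
qed

text \<open>A norm bound chosen strictly positive even for \<open>K = 0\<close>, since
  \<open>c\<close> divides by it.\<close>

definition L where "L = (SOME L. 0 < L \<and> (\<forall>u. norm (T u) \<le> norm u * L))"

lemma L: "0 < L" "norm (T u) \<le> L * norm u"
proof -
  have "\<exists>L. 0 < L \<and> (\<forall>u. norm (T u) \<le> norm u * L)"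
    using bounded_linear.pos_bounded[OF matrix_vector_mul_bounded_linear, of "transpose K"] by blast
  from someI_ex[OF this] show "0 < L" "norm (T u) \<le> L * norm u"
    unfolding L_def[symmetric] by (auto simp: mult.commute)
qed

text \<open>The square root turns the linesearch bound on a product of two consecutive steps into a
  threshold for single steps.\<close>

definition c where "c = sqrt (\<mu> * (\<sigma>\<^sup>2 * \<psi> / (\<beta> * L\<^sup>2)))"

lemma c_pos: "0 < c"
  using mu sigma psi beta L(1) by (simp add: c_def)

lemma c_square: "c\<^sup>2 = \<mu> * (\<sigma>\<^sup>2 * \<psi> / (\<beta> * L\<^sup>2))"
  using mu sigma psi beta L(1) by (simp add: c_def)

text \<open>Positivity of \<open>\<tau> n\<close> is a premise because \<open>tau_pos\<close> is the
  induction built on this lemma.\<close>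

lemma step:
  assumes "0 < \<tau> n"
  shows "0 < \<tau> (Suc n) \<and> \<tau> (Suc n) \<le> \<phi> * \<tau> n
    \<and> linesearch_ok f K \<psi> \<sigma> \<beta> (\<tau> n) (\<tau> (Suc n)) (x (Suc n)) (y n)
    \<and> (\<tau> (Suc n) = \<phi> * \<tau> n \<or> c\<^sup>2 \<le> \<tau> (Suc n) * \<tau> n)"
  unfolding c_square
  using mu sigma psi beta L assms phi_gt_1
  by (intro linesearch_step[where r = "\<phi> * \<tau> n" and \<mu> = \<mu>, OF _ _ _ _ _ _ _ _ _ tau_Suc]) auto

lemma tau_pos: "0 < \<tau> n"
  by (induction n) (use tau0 step in auto)

lemma tau_le: "\<tau> (Suc n) \<le> \<phi> * \<tau> n"
  using step[OF tau_pos] by blast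

lemma x_subgradient:
  "(1 / \<tau> n) *\<^sub>R (z (Suc n) - \<tau> n *\<^sub>R T (y n) - x (Suc n)) \<in> subdifferential g (x (Suc n))"
  using sol unfolding x_Suc[of n] saddle_solutions_iff
  by (blast intro: prox_subdifferential[OF g tau_pos])

lemma y_subgradient:
  "(1 / (\<beta> * \<tau> (Suc n))) *\<^sub>R (y n + (\<beta> * \<tau> (Suc n)) *\<^sub>R (K *v x (Suc n)) - y (Suc n))
    \<in> subdifferential F (y (Suc n))"
proof -
  have "K *v xs \<in> subdifferential F ys" using sol by (simp add: saddle_solutions_iff)
  then show ?thesis
    unfolding y_Suc[of n] dual_step_def
    by (rule prox_subdifferential[OF f_conj, rotated]) (use beta tau_pos in auto)
qed

lemma linesearch_bound:
  "\<tau> (Suc n) * norm (T (y (Suc n)) - T (y n))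
    \<le> \<sigma> * sqrt (\<psi> * (\<tau> (Suc n) / \<tau> n)) * sqrt (1 / \<beta>) * norm (y (Suc n) - y n)"
proof -
  define t s where "t = \<tau> (Suc n)" and "s = \<tau> n"
  have pos: "0 < t" "0 < s" using tau_pos by (auto simp: t_def s_def)
  have "sqrt (\<beta> * t) * norm (T (y (Suc n)) - T (y n)) \<le> \<sigma> * sqrt (\<psi> / s) * norm (y (Suc n) - y n)"
    using step[OF tau_pos, of n] unfolding linesearch_ok_def Let_def y_Suc[symmetric] t_def s_def
    by blast
  \<comment> \<open>The factor \<open>sqrt (t / \<beta>)\<close> turns
    \<open>sqrt (\<beta> * t)\<close> into \<open>t\<close> and \<open>sqrt (\<psi> / s)\<close>
    into the root of the step ratio, the form used in \<open>energy_descent\<close>.\<close>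
  then have "sqrt (t / \<beta>) * (sqrt (\<beta> * t) * norm (T (y (Suc n)) - T (y n)))
      \<le> sqrt (t / \<beta>) * (\<sigma> * sqrt (\<psi> / s) * norm (y (Suc n) - y n))"
    using pos beta by (intro mult_left_mono) auto
  also have "\<dots> = \<sigma> * (sqrt (t / \<beta>) * sqrt (\<psi> / s)) * norm (y (Suc n) - y n)"
    by (simp only: mult_ac)
  also have "sqrt (t / \<beta>) * sqrt (\<psi> / s) = sqrt (\<psi> * (t / s)) * sqrt (1 / \<beta>)"
    by (simp add: real_sqrt_mult[symmetric] mult_ac)
  also have "sqrt (t / \<beta>) * (sqrt (\<beta> * t) * norm (T (y (Suc n)) - T (y n)))
      = sqrt (t / \<beta>) * sqrt (\<beta> * t) * norm (T (y (Suc n)) - T (y n))"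
    by (simp only: mult.assoc)
  also have "sqrt (t / \<beta>) * sqrt (\<beta> * t) = t"
    using pos beta by (simp add: real_sqrt_mult[symmetric])
  finally show ?thesis
    unfolding t_def[symmetric] s_def[symmetric] by (simp only: mult.assoc)
qed

section \<open>Monotone energy around a saddle point\<close>

text \<open>\<open>z\<close> runs two indices ahead because the dual update to
  \<open>y (Suc n)\<close> is paired with the primal update to \<open>x (n + 2)\<close>: both use
  the step \<open>\<tau> (Suc n)\<close>, and the latter is centred at
  \<open>z (n + 2)\<close>.\<close>

definition energy where
  "energy x' y' n = \<psi> / (\<psi> - 1) * (norm (z (n + 2) - x'))\<^sup>2 + (1 / \<beta>) * (norm (y n - y'))\<^sup>2"

text \<open>The primal residuals are weighted by the step ratio, so they are controlled only where
  that ratio is bounded below.\<close>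

definition decrease where
  "decrease n = (1 - \<sigma>) * (\<psi> * (\<tau> (Suc n) / \<tau> n) * (norm (x (n + 2) - x (Suc n)))\<^sup>2
      + (1 / \<beta>) * (norm (y (Suc n) - y n))\<^sup>2)
    + \<psi> * (\<tau> (Suc n) / \<tau> n) * (norm (x (Suc n) - z (n + 2)))\<^sup>2"

lemma energy_step:
  assumes s: "(x', y') \<in> saddle_solutions g f K"
  shows "energy x' y' (Suc n) + decrease n \<le> energy x' y' n"
proof -
  define t s where "t = \<tau> (Suc n)" and "s = \<tau> n"
  have pos: "0 < t" "0 < s" using tau_pos by (auto simp: t_def s_def)
  define x1 x2 z0 z1 y0 y1 where "x1 = x (Suc n)" and "x2 = x (n + 2)" and "z0 = z (Suc n)"
    and "z1 = z (n + 2)" and "y0 = y n" and "y1 = y (Suc n)"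
  note defs = x1_def x2_def z0_def z1_def y0_def y1_def t_def s_def
  have g1: "(1 / s) *\<^sub>R (z0 - s *\<^sub>R T y0 - x1) \<in> subdifferential g x1"
    unfolding defs by (rule x_subgradient)
  have g2: "(1 / t) *\<^sub>R (z1 - t *\<^sub>R T y1 - x2) \<in> subdifferential g x2"
    unfolding defs using x_subgradient[of "Suc n"] by simp
  have f1: "(1 / (\<beta> * t)) *\<^sub>R (y0 + (\<beta> * t) *\<^sub>R (K *v x1) - y1) \<in> subdifferential F y1"
    unfolding defs by (rule y_subgradient)
  have gs: "- T y' \<in> subdifferential g x'" and fs: "K *v x' \<in> subdifferential F y'"
    using s by (simp_all add: saddle_solutions_iff)
  define G F' where "G u = real_of_ereal (g u)" and "F' v = real_of_ereal (F v)" for u v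
  note fing = subdifferential_finite[OF g g1] subdifferential_finite[OF g g2] subdifferential_finite[OF g gs]
  note finf = subdifferential_finite[OF f_conj f1] subdifferential_finite[OF f_conj fs]
  \<comment> \<open>Trades the older centre \<open>z0\<close> for \<open>z1\<close>; this is the
    source of the factor \<open>\<psi> * (t / s)\<close> in \<open>i2\<close>.\<close>
  have z01: "z0 - x1 = - \<psi> *\<^sub>R (x1 - z1)"
  proof -
    have "\<psi> *\<^sub>R z1 = (\<psi> - 1) *\<^sub>R x1 + z0"
      unfolding defs using z_Suc[of "Suc n"] psi by (simp add: scaleR_right_distrib)
    then show ?thesis by (simp add: algebra_simps)
  qed
  \<comment> \<open>\<open>i1\<close> to \<open>i5\<close> are the five subgradient inequalities,
    all scaled by \<open>t\<close> so that the function values cancel in the sum.\<close>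
  have i1: "t * G x2 - (x2 - z1) \<bullet> (x' - x2) - t * (T y1 \<bullet> (x' - x2)) \<le> t * G x'"
  proof -
    have "t * (G x2 + (1 / t) *\<^sub>R (z1 - t *\<^sub>R T y1 - x2) \<bullet> (x' - x2)) \<le> t * G x'"
      using subdifferential_real_ineq[OF g2 fing(2,3)] pos unfolding G_def
      by (intro mult_left_mono) auto
    moreover have "t * (G x2 + (1 / t) *\<^sub>R (z1 - t *\<^sub>R T y1 - x2) \<bullet> (x' - x2))
        = t * G x2 - (x2 - z1) \<bullet> (x' - x2) - t * (T y1 \<bullet> (x' - x2))"
      using pos by (simp add: distrib_left inner_diff_left del: transpose_matrix_vector)
    ultimately show ?thesis by simp
  qed
  have i2: "t * G x1 - \<psi> * (t / s) * ((x1 - z1) \<bullet> (x2 - x1)) - t * (T y0 \<bullet> (x2 - x1)) \<le> t * G x2"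
  proof -
    have "t * (G x1 + (1 / s) *\<^sub>R (z0 - s *\<^sub>R T y0 - x1) \<bullet> (x2 - x1)) \<le> t * G x2"
      using subdifferential_real_ineq[OF g1 fing(1,2)] pos unfolding G_def
      by (intro mult_left_mono) auto
    moreover have "(z0 - s *\<^sub>R T y0 - x1) \<bullet> (x2 - x1)
        = - \<psi> * ((x1 - z1) \<bullet> (x2 - x1)) - s * (T y0 \<bullet> (x2 - x1))"
    proof -
      have "z0 - s *\<^sub>R T y0 - x1 = - \<psi> *\<^sub>R (x1 - z1) - s *\<^sub>R T y0"
        unfolding z01[symmetric] by simp
      then show ?thesis
        by (simp only: inner_diff_left[of "- \<psi> *\<^sub>R (x1 - z1)" "s *\<^sub>R T y0"] inner_scaleR_left)
    qed
    ultimately show ?thesis using pos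
      by (simp add: distrib_left right_diff_distrib mult_ac del: transpose_matrix_vector)
  qed
  have i3: "t * F' y1 - (1 / \<beta>) * ((y1 - y0) \<bullet> (y' - y1)) + t * (x1 \<bullet> T y' - x1 \<bullet> T y1) \<le> t * F' y'"
  proof -
    have "t * (F' y1 + (1 / (\<beta> * t)) *\<^sub>R (y0 + (\<beta> * t) *\<^sub>R (K *v x1) - y1) \<bullet> (y' - y1)) \<le> t * F' y'"
      using subdifferential_real_ineq[OF f1 finf] pos unfolding F'_def
      by (intro mult_left_mono) auto
    moreover have "(y0 + (\<beta> * t) *\<^sub>R (K *v x1) - y1) \<bullet> (y' - y1)
        = - ((y1 - y0) \<bullet> (y' - y1)) + \<beta> * t * (x1 \<bullet> T y' - x1 \<bullet> T y1)"
    proof -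
      have "(K *v x1) \<bullet> (y' - y1) = x1 \<bullet> T y' - x1 \<bullet> T y1"
        by (simp only: inner_diff_right matrix_inner_transpose)
      moreover have "y0 + (\<beta> * t) *\<^sub>R (K *v x1) - y1 = (\<beta> * t) *\<^sub>R (K *v x1) - (y1 - y0)" by simp
      ultimately show ?thesis
        by (simp only: inner_diff_left[of "(\<beta> * t) *\<^sub>R (K *v x1)" "y1 - y0"] inner_scaleR_left)
    qed
    moreover have "t * (F' y1 + (1 / (\<beta> * t)) * (- e + \<beta> * t * d)) = t * F' y1 - (1 / \<beta>) * e + t * d"
      for e d
      using pos beta by (simp add: field_simps)
    ultimately show ?thesis by (simp only: inner_scaleR_left)
  qed
  have i4: "t * G x' - t * (T y' \<bullet> (x1 - x')) \<le> t * G x1"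
  proof -
    have "G x' + (- T y') \<bullet> (x1 - x') \<le> G x1"
      using subdifferential_real_ineq[OF gs fing(3,1)] unfolding G_def .
    then have "t * (G x' + (- T y') \<bullet> (x1 - x')) \<le> t * G x1"
      using pos by (intro mult_left_mono) auto
    then show ?thesis by (simp add: right_diff_distrib del: transpose_matrix_vector)
  qed
  have i5: "t * F' y' + t * (x' \<bullet> T y1 - x' \<bullet> T y') \<le> t * F' y1"
  proof -
    have "F' y' + (K *v x') \<bullet> (y1 - y') \<le> F' y1"
      using subdifferential_real_ineq[OF fs finf(2,1)] unfolding F'_def .
    then have "t * (F' y' + (K *v x') \<bullet> (y1 - y')) \<le> t * F' y1"
      using pos by (intro mult_left_mono) auto
    then show ?thesis by (simp only: distrib_left inner_diff_right matrix_inner_transpose)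
  qed
  have sum: "0 \<le> (x2 - z1) \<bullet> (x' - x2) + \<psi> * (t / s) * ((x1 - z1) \<bullet> (x2 - x1))
        + (1 / \<beta>) * ((y1 - y0) \<bullet> (y' - y1)) + t * ((T y0 - T y1) \<bullet> (x2 - x1))"
  proof -
    \<comment> \<open>With the inner products named, the coupling terms collapse to the difference
      \<open>v0 - v1\<close> and the rest is linear.\<close>
    define a b e where "a = (x2 - z1) \<bullet> (x' - x2)" and "b = \<psi> * (t / s) * ((x1 - z1) \<bullet> (x2 - x1))"
      and "e = (1 / \<beta>) * ((y1 - y0) \<bullet> (y' - y1))"
    define v0 v1 v' where "v0 = T y0" and "v1 = T y1" and "v' = T y'"
    have "t * (v1 \<bullet> (x' - x2)) + t * (v0 \<bullet> (x2 - x1)) - t * (x1 \<bullet> v' - x1 \<bullet> v1)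
        + t * (v' \<bullet> (x1 - x')) - t * (x' \<bullet> v1 - x' \<bullet> v') = t * ((v0 - v1) \<bullet> (x2 - x1))"
      by (simp add: algebra_simps inner_commute)
    then show ?thesis
      using i1 i2 i3 i4 i5
      unfolding a_def[symmetric] b_def[symmetric] e_def[symmetric]
        v0_def[symmetric] v1_def[symmetric] v'_def[symmetric] by linarith
  qed
  have z2: "z (Suc n + 2) = ((\<psi> - 1) / \<psi>) *\<^sub>R x2 + (1 / \<psi>) *\<^sub>R z1"
    unfolding defs using z_Suc[of "n + 2"] by simp
  \<comment> \<open>The growth cap \<open>\<phi>\<close> is tuned so that
    \<open>\<psi> * \<phi>\<close> is the largest value \<open>energy_descent\<close>
    admits.\<close>
  have "\<psi> * (t / s) \<le> \<psi> * \<phi>"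
    using tau_le[of n] pos psi unfolding t_def s_def by (intro mult_left_mono) (simp_all add: field_simps)
  also have "\<psi> * \<phi> = 1 + 1 / \<psi>" using psi by (simp add: field_simps power2_eq_square)
  finally have "\<psi> * (t / s) \<le> 1 + 1 / \<psi>" .
  from energy_descent[OF sum z2 _ psi(1) beta _ this] linesearch_bound[of n] sigma pos
  show ?thesis
    unfolding energy_def decrease_def defs by simp
qed

lemma decrease_nonneg: "0 \<le> decrease n"
  unfolding decrease_def using sigma psi beta tau_pos[of n] tau_pos[of "Suc n"]
  by (intro add_nonneg_nonneg mult_nonneg_nonneg) auto

lemma energy_nonneg: "0 \<le> energy x' y' n"
  unfolding energy_def using psi beta by (intro add_nonneg_nonneg mult_nonneg_nonneg) auto

lemma energy_decseq:
  assumes "(x', y') \<in> saddle_solutions g f K"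
  shows "decseq (energy x' y')"
proof (rule decseq_SucI)
  show "energy x' y' (Suc n) \<le> energy x' y' n" for n
    using energy_step[OF assms, of n] decrease_nonneg[of n] by linarith
qed

lemma energy_convergent:
  assumes "(x', y') \<in> saddle_solutions g f K"
  shows "convergent (energy x' y')"
proof -
  have nonneg: "\<forall>n. 0 \<le> energy x' y' n" by (simp add: energy_nonneg)
  show ?thesis
    by (rule decseq_convergent[OF energy_decseq[OF assms] nonneg]) (rule convergentI)
qed

lemma energy_tendsto_0D:
  assumes "(\<lambda>n. energy x' y' (s n)) \<longlonglongrightarrow> 0"
  shows "(\<lambda>n. z (s n + 2)) \<longlonglongrightarrow> x'" "(\<lambda>n. y (s n)) \<longlonglongrightarrow> y'"
proof -
  have p: "0 < \<psi> / (\<psi> - 1)" using psi by simp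
  have 1: "\<psi> / (\<psi> - 1) * (norm (z (s n + 2) - x'))\<^sup>2 \<le> energy x' y' (s n)" for n
    unfolding energy_def using beta by simp
  have 2: "(1 / \<beta>) * (norm (y (s n) - y'))\<^sup>2 \<le> energy x' y' (s n)" for n
    unfolding energy_def using p by (simp del: times_divide_eq_left)
  have "(norm (z (s n + 2) - x'))\<^sup>2 \<le> ((\<psi> - 1) / \<psi>) * energy x' y' (s n)" for n
    using 1[of n] psi by (simp add: field_simps)
  then show "(\<lambda>n. z (s n + 2)) \<longlonglongrightarrow> x'"
    by (rule LIM_zero_cancel[OF tendsto_zero_norm_square_le[OF _ assms]])
  have "(norm (y (s n) - y'))\<^sup>2 \<le> \<beta> * energy x' y' (s n)" for n
    using 2[of n] beta by (simp add: field_simps)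
  then show "(\<lambda>n. y (s n)) \<longlonglongrightarrow> y'"
    by (rule LIM_zero_cancel[OF tendsto_zero_norm_square_le[OF _ assms]])
qed

text \<open>Each decrease is at most a difference of consecutive energies, and the energy
  converges.\<close>

lemma decrease_tendsto_0: "decrease \<longlonglongrightarrow> 0"
proof -
  obtain l where l: "energy xs ys \<longlonglongrightarrow> l"
    using energy_convergent[OF sol] unfolding convergent_def by (rule exE)
  have "(\<lambda>n. energy xs ys n - energy xs ys (Suc n)) \<longlonglongrightarrow> l - l"
    by (intro tendsto_diff l LIMSEQ_Suc)
  then have lim: "(\<lambda>n. energy xs ys n - energy xs ys (Suc n)) \<longlonglongrightarrow> 0" by simp
  have "decrease n \<le> energy xs ys n - energy xs ys (Suc n)" for n
    using energy_step[OF sol, of n] by linarith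
  then show ?thesis
    using decrease_nonneg
    by (intro tendsto_sandwich[OF _ _ tendsto_const lim] always_eventually allI) auto
qed

lemma bounded_iterates: "bounded (range (\<lambda>n. (z (n + 2), y n)))"
proof -
  have le: "energy xs ys n \<le> energy xs ys 0" for n
    using decseqD[OF energy_decseq[OF sol], of 0 n] by simp
  have p: "0 < \<psi> / (\<psi> - 1)" "0 < 1 / \<beta>" using psi beta by auto
  have "\<psi> / (\<psi> - 1) * (norm (z (n + 2) - xs))\<^sup>2 \<le> energy xs ys 0" for n
    by (rule order_trans[OF _ le[of n]]) (use beta in \<open>simp add: energy_def\<close>)
  moreover have "(1 / \<beta>) * (norm (y n - ys))\<^sup>2 \<le> energy xs ys 0" for n
    by (rule order_trans[OF _ le[of n]]) (use p(1) in \<open>simp add: energy_def del: times_divide_eq_left\<close>)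
  ultimately have "bounded (range (\<lambda>n. z (n + 2)))" "bounded (range y)"
    using p by (blast intro: bounded_range_of_weighted_square_le)+
  then show ?thesis
    by (intro bounded_subset[OF bounded_Times]) auto
qed

section \<open>Cluster points and convergence of the whole sequence\<close>

text \<open>The subsequence is chosen inside the good indices \<open>S\<close> first. There the
  ratio is at least \<open>1 / 2\<close>, so vanishing decrease forces vanishing residuals, and the
  step is at least \<open>c\<close>, so residuals divided by it still vanish.\<close>

lemma cluster_point:
  obtains s xb yb where "strict_mono s" "(xb, yb) \<in> saddle_solutions g f K"
    "(\<lambda>n. z (s n + 2)) \<longlonglongrightarrow> xb" "(\<lambda>n. y (s n)) \<longlonglongrightarrow> yb"
proof -
  define S where "S = {n. c \<le> \<tau> (Suc n) \<and> \<tau> n \<le> 2 * \<tau> (Suc n)}"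
  have "\<exists>n\<ge>N. n \<in> S" for N
    unfolding S_def mem_Collect_eq
    using step[OF tau_pos] by (intro step_ratio_infinitely_often[OF tau_pos phi_gt_1 c_pos]) blast
  then have "infinite S" by (simp add: infinite_nat_iff_unbounded_le)
  then obtain r :: "nat \<Rightarrow> nat" where r: "strict_mono r" "\<And>n. r n \<in> S"
    using infinite_enumerate by blast
  have "bounded (range (\<lambda>n. (z (r n + 2), y (r n))))"
    by (rule bounded_subset[OF bounded_iterates]) auto
  from bounded_imp_convergent_subsequence[OF this]
  obtain l r' where r': "strict_mono r'" "((\<lambda>n. (z (r n + 2), y (r n))) \<circ> r') \<longlonglongrightarrow> l"
    by blast
  obtain xb yb where l: "l = (xb, yb)" by (cases l)
  define s where "s = r \<circ> r'"
  have s: "strict_mono s" unfolding s_def using r(1) r'(1) by (rule strict_mono_o)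
  have sS: "c \<le> \<tau> (Suc (s n))" "\<tau> (s n) \<le> 2 * \<tau> (Suc (s n))" for n
    using r(2)[of "r' n"] by (auto simp: S_def s_def)
  have zlim: "(\<lambda>n. z (s n + 2)) \<longlonglongrightarrow> xb" and ylim: "(\<lambda>n. y (s n)) \<longlonglongrightarrow> yb"
    using tendsto_fst[OF r'(2)] tendsto_snd[OF r'(2)] by (simp_all add: l s_def o_def)
  have Dlim: "(\<lambda>n. decrease (s n)) \<longlonglongrightarrow> 0"
    using LIMSEQ_subseq_LIMSEQ[OF decrease_tendsto_0 s] by (simp add: o_def)
  \<comment> \<open>The largest of the three constants obtained by solving each term of
    \<open>decrease\<close> for its square with ratio \<open>1 / 2\<close>.\<close>
  define C where "C = max (2 / ((1 - \<sigma>) * \<psi>)) (max (\<beta> / (1 - \<sigma>)) (2 / \<psi>))"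
  have le: "(norm (x (s n + 2) - x (Suc (s n))))\<^sup>2 \<le> C * decrease (s n)
      \<and> (norm (y (Suc (s n)) - y (s n)))\<^sup>2 \<le> C * decrease (s n)
      \<and> (norm (x (Suc (s n)) - z (s n + 2)))\<^sup>2 \<le> C * decrease (s n)" for n
  proof -
    define a b e d where "a = (norm (x (s n + 2) - x (Suc (s n))))\<^sup>2"
      and "b = (norm (y (Suc (s n)) - y (s n)))\<^sup>2"
      and "e = (norm (x (Suc (s n)) - z (s n + 2)))\<^sup>2"
      and "d = \<tau> (Suc (s n)) / \<tau> (s n)"
    have nn: "0 \<le> a" "0 \<le> b" "0 \<le> e" by (auto simp: a_def b_def e_def)
    have d: "1 / 2 \<le> d" using sS(2)[of n] tau_pos[of "s n"] by (simp add: d_def field_simps)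
    have D: "decrease (s n) = (1 - \<sigma>) * (\<psi> * d * a + (1 / \<beta>) * b) + \<psi> * d * e"
      by (simp add: decrease_def a_def b_def e_def d_def)
    have D': "(1 - \<sigma>) * (\<psi> * (1 / 2) * a + (1 / \<beta>) * b) + \<psi> * (1 / 2) * e \<le> decrease (s n)"
      unfolding D using d nn psi sigma
      by (intro add_mono mult_left_mono mult_right_mono) auto
    have 1: "(1 - \<sigma>) * (\<psi> * (1 / 2) * a) \<le> decrease (s n)"
      and 2: "(1 - \<sigma>) * ((1 / \<beta>) * b) \<le> decrease (s n)"
      and 3: "\<psi> * (1 / 2) * e \<le> decrease (s n)"
    proof -
      have "0 \<le> (1 - \<sigma>) * (\<psi> * (1 / 2) * a)" "0 \<le> (1 - \<sigma>) * ((1 / \<beta>) * b)" "0 \<le> \<psi> * (1 / 2) * e"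
        using nn psi sigma beta by auto
      with D'[unfolded distrib_left[of "1 - \<sigma>"]]
      show "(1 - \<sigma>) * (\<psi> * (1 / 2) * a) \<le> decrease (s n)"
        "(1 - \<sigma>) * ((1 / \<beta>) * b) \<le> decrease (s n)" "\<psi> * (1 / 2) * e \<le> decrease (s n)"
        by linarith+
    qed
    have "a \<le> 2 / ((1 - \<sigma>) * \<psi>) * decrease (s n)" using 1 psi sigma by (simp add: field_simps)
    also have "\<dots> \<le> C * decrease (s n)"
      unfolding C_def by (intro mult_right_mono decrease_nonneg) simp
    finally have "a \<le> C * decrease (s n)" .
    moreover have "b \<le> \<beta> / (1 - \<sigma>) * decrease (s n)" using 2 beta sigma by (simp add: field_simps)
    then have "b \<le> C * decrease (s n)"
      by (rule order_trans) (unfold C_def, intro mult_right_mono decrease_nonneg, simp)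
    moreover have "e \<le> 2 / \<psi> * decrease (s n)" using 3 psi by (simp add: field_simps)
    then have "e \<le> C * decrease (s n)"
      by (rule order_trans) (unfold C_def, intro mult_right_mono decrease_nonneg, simp)
    ultimately show ?thesis by (simp add: a_def b_def e_def)
  qed
  have dx: "(\<lambda>n. x (s n + 2) - x (Suc (s n))) \<longlonglongrightarrow> 0"
    and dy: "(\<lambda>n. y (Suc (s n)) - y (s n)) \<longlonglongrightarrow> 0"
    and dz: "(\<lambda>n. x (Suc (s n)) - z (s n + 2)) \<longlonglongrightarrow> 0"
    by (rule tendsto_zero_norm_square_le[OF _ Dlim], use le in blast)+
  have x1lim: "(\<lambda>n. x (Suc (s n))) \<longlonglongrightarrow> xb"
    using tendsto_add[OF dz zlim] by simp
  have x2lim: "(\<lambda>n. x (s n + 2)) \<longlonglongrightarrow> xb"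
    using tendsto_add[OF dx x1lim] by simp
  have y1lim: "(\<lambda>n. y (Suc (s n))) \<longlonglongrightarrow> yb"
    using tendsto_add[OF dy ylim] by simp
  have scaled: "(\<lambda>n. (1 / \<tau> (Suc (s n))) *\<^sub>R a n) \<longlonglongrightarrow> 0" if "a \<longlonglongrightarrow> 0"
    for a :: "nat \<Rightarrow> real^'q"
    using that by (rule tendsto_zero_scaleR_bounded[where B = "1 / c"])
  (use sS(1) c_pos tau_pos in \<open>simp add: abs_of_pos frac_le\<close>)
  have scaled': "(\<lambda>n. (1 / \<tau> (Suc (s n))) *\<^sub>R a n) \<longlonglongrightarrow> 0" if "a \<longlonglongrightarrow> 0"
    for a :: "nat \<Rightarrow> real^'p"
    using that by (rule tendsto_zero_scaleR_bounded[where B = "1 / c"])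
  (use sS(1) c_pos tau_pos in \<open>simp add: abs_of_pos frac_le\<close>)
  have "- T yb \<in> subdifferential g xb"
  proof (rule subdifferential_closed_graph[OF g _ x2lim])
    show "(1 / \<tau> (Suc (s n))) *\<^sub>R (z (s n + 2) - \<tau> (Suc (s n)) *\<^sub>R T (y (Suc (s n))) - x (s n + 2))
        \<in> subdifferential g (x (s n + 2))" for n
      using x_subgradient[of "Suc (s n)"] by simp
    \<comment> \<open>The subgradient splits into a residual over the step, which vanishes, and a
      continuous linear term; the closed graph then gives the limit inclusion. The dual inclusion
      follows the same pattern.\<close>
    have "(\<lambda>n. (1 / \<tau> (Suc (s n))) *\<^sub>R (z (s n + 2) - x (s n + 2)) - T (y (Suc (s n))))
        \<longlonglongrightarrow> 0 - T yb"
    proof (intro tendsto_diff scaled)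
      show "(\<lambda>n. z (s n + 2) - x (s n + 2)) \<longlonglongrightarrow> 0"
        using tendsto_diff[OF zlim x2lim] by simp
      show "(\<lambda>n. T (y (Suc (s n)))) \<longlonglongrightarrow> T yb"
        by (rule bounded_linear.tendsto[OF matrix_vector_mul_bounded_linear y1lim])
    qed
    moreover have "(1 / \<tau> (Suc (s n))) *\<^sub>R (z (s n + 2) - \<tau> (Suc (s n)) *\<^sub>R T (y (Suc (s n))) - x (s n + 2))
        = (1 / \<tau> (Suc (s n))) *\<^sub>R (z (s n + 2) - x (s n + 2)) - T (y (Suc (s n)))" for n
      using tau_pos[of "Suc (s n)"] by (simp add: scaleR_right_diff_distrib)
    ultimately show "(\<lambda>n. (1 / \<tau> (Suc (s n))) *\<^sub>R
        (z (s n + 2) - \<tau> (Suc (s n)) *\<^sub>R T (y (Suc (s n))) - x (s n + 2))) \<longlonglongrightarrow> - T yb"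
      by simp
  qed
  moreover have "K *v xb \<in> subdifferential F yb"
  proof (rule subdifferential_closed_graph[OF f_conj _ y1lim])
    show "(1 / (\<beta> * \<tau> (Suc (s n)))) *\<^sub>R (y (s n) + (\<beta> * \<tau> (Suc (s n))) *\<^sub>R (K *v x (Suc (s n))) - y (Suc (s n)))
        \<in> subdifferential F (y (Suc (s n)))" for n
      by (rule y_subgradient)
    have "(\<lambda>n. (1 / \<tau> (Suc (s n))) *\<^sub>R ((1 / \<beta>) *\<^sub>R (y (s n) - y (Suc (s n)))) + K *v x (Suc (s n)))
        \<longlonglongrightarrow> 0 + K *v xb"
    proof (intro tendsto_add scaled')
      show "(\<lambda>n. (1 / \<beta>) *\<^sub>R (y (s n) - y (Suc (s n)))) \<longlonglongrightarrow> 0"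
        using tendsto_scaleR[OF tendsto_const[of "1 / \<beta>"] tendsto_diff[OF ylim y1lim]] by simp
      show "(\<lambda>n. K *v x (Suc (s n))) \<longlonglongrightarrow> K *v xb"
        by (rule bounded_linear.tendsto[OF matrix_vector_mul_bounded_linear x1lim])
    qed
    moreover have "(1 / (\<beta> * \<tau> (Suc (s n)))) *\<^sub>R (y (s n) + (\<beta> * \<tau> (Suc (s n))) *\<^sub>R (K *v x (Suc (s n))) - y (Suc (s n)))
        = (1 / \<tau> (Suc (s n))) *\<^sub>R ((1 / \<beta>) *\<^sub>R (y (s n) - y (Suc (s n)))) + K *v x (Suc (s n))" for n
      using tau_pos[of "Suc (s n)"] beta
      by (simp add: scaleR_right_diff_distrib scaleR_right_distrib mult.commute)
    ultimately show "(\<lambda>n. (1 / (\<beta> * \<tau> (Suc (s n)))) *\<^sub>R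
        (y (s n) + (\<beta> * \<tau> (Suc (s n))) *\<^sub>R (K *v x (Suc (s n))) - y (Suc (s n)))) \<longlonglongrightarrow> K *v xb"
      by simp
  qed
  ultimately have "(xb, yb) \<in> saddle_solutions g f K" by (simp add: saddle_solutions_iff)
  with s zlim ylim show thesis using that by blast
qed

text \<open>The energy centred at the cluster point is monotone and tends to \<open>0\<close> along
  the subsequence, hence along all indices.\<close>

lemma iterates_converge: "\<exists>w \<in> saddle_solutions g f K. (\<lambda>n. (x n, y n)) \<longlonglongrightarrow> w"
proof -
  obtain s xb yb where s: "strict_mono s" and sb: "(xb, yb) \<in> saddle_solutions g f K"
    and lim: "(\<lambda>n. z (s n + 2)) \<longlonglongrightarrow> xb" "(\<lambda>n. y (s n)) \<longlonglongrightarrow> yb"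
    by (rule cluster_point)
  obtain l where l: "energy xb yb \<longlonglongrightarrow> l"
    using energy_convergent[OF sb] unfolding convergent_def by (rule exE)
  have 1: "(\<lambda>n. energy xb yb (s n)) \<longlonglongrightarrow> \<psi> / (\<psi> - 1) * (norm (xb - xb))\<^sup>2 + (1 / \<beta>) * (norm (yb - yb))\<^sup>2"
    unfolding energy_def by (intro tendsto_intros lim)
  have 2: "(\<lambda>n. energy xb yb (s n)) \<longlonglongrightarrow> l"
    using LIMSEQ_subseq_LIMSEQ[OF l s] by (simp add: o_def)
  have "l = 0" using LIMSEQ_unique[OF 1 2] by simp
  then have "(\<lambda>n. energy xb yb (id n)) \<longlonglongrightarrow> 0" using l by simp
  from energy_tendsto_0D[OF this] have z2: "(\<lambda>n. z (n + 2)) \<longlonglongrightarrow> xb" and ylim: "y \<longlonglongrightarrow> yb"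
    by simp_all
  have zlim: "z \<longlonglongrightarrow> xb" by (rule LIMSEQ_offset[OF z2])
  \<comment> \<open>The averaging rule for \<open>z\<close>, solved for \<open>x n\<close>,
    expresses it by two consecutive \<open>z\<close>, so \<open>x\<close> inherits their
    limit.\<close>
  have "(\<lambda>n. (1 / (\<psi> - 1)) *\<^sub>R (\<psi> *\<^sub>R z (Suc n) - z n)) \<longlonglongrightarrow> (1 / (\<psi> - 1)) *\<^sub>R (\<psi> *\<^sub>R xb - xb)"
    by (intro tendsto_intros LIMSEQ_Suc zlim)
  moreover have "(1 / (\<psi> - 1)) *\<^sub>R (\<psi> *\<^sub>R z (Suc n) - z n) = x n" for n
    using psi unfolding z_Suc by (simp add: scaleR_right_distrib)
  moreover have "(1 / (\<psi> - 1)) *\<^sub>R (\<psi> *\<^sub>R xb - xb) = xb"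
  proof -
    have "\<psi> *\<^sub>R xb - xb = (\<psi> - 1) *\<^sub>R xb" by (simp add: scaleR_left_diff_distrib)
    then show ?thesis using psi by simp
  qed
  ultimately have "x \<longlonglongrightarrow> xb" by simp
  with ylim sb show ?thesis by (intro bexI[of _ "(xb, yb)"] tendsto_Pair)
qed

end

theorem theorem3p1:
  fixes f :: "real^'p \<Rightarrow> ereal" and g :: "real^'q \<Rightarrow> ereal" and K :: "real^'q^'p"
    and \<psi> \<sigma> \<beta> \<mu> :: real
    and z x :: "nat \<Rightarrow> real^'q" and y :: "nat \<Rightarrow> real^'p" and \<tau> :: "nat \<Rightarrow> real"
  assumes "closed_proper_convex f" and "closed_proper_convex g"
    and "primal_minimizers g f K \<noteq> {}"
    and "\<exists>xt \<in> rel_interior (eff_dom g). K *v xt \<in> rel_interior (eff_dom f)"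
    and "1 < \<psi>" and "\<psi> < (sqrt 5 + 1) / 2"
    and "0 < \<sigma>" and "\<sigma> < 1"
    and "0 < \<beta>"
    and "0 < \<mu>" and "\<mu> < 1"
    and "0 < \<tau> 0"
    and "grpda_l g f K \<psi> \<sigma> \<beta> \<mu> z x y \<tau>"
  shows "\<exists>w \<in> saddle_solutions g f K. (\<lambda>n. (x n, y n)) \<longlonglongrightarrow> w"
proof -
  obtain xs where xs: "xs \<in> primal_minimizers g f K"
    using assms(3) by blast
  from assms(4) obtain xt where xt: "xt \<in> rel_interior (eff_dom g)" "K *v xt \<in> rel_interior (eff_dom f)"
    by (rule bexE)
  obtain ys where ys: "- (transpose K *v ys) \<in> subdifferential g xs"
    "ys \<in> subdifferential f (K *v xs)"
    by (rule exists_dual_multiplier[OF assms(1,2) xs xt])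
  \<comment> \<open>The multiplier is a subgradient of \<open>f\<close>, which is what properness of
    the conjugate is derived from.\<close>
  have conj: "closed_proper_convex (fenchel_conjugate f)"
    by (rule closed_proper_convex_fenchel_conjugate[OF assms(1) ys(2)])
  have sol: "(xs, ys) \<in> saddle_solutions g f K"
    unfolding saddle_solutions_iff
    using ys(1) subdifferential_fenchel_conjugate[OF assms(1) ys(2)] by (rule conjI)
  interpret grpda_l_run f g K \<psi> \<sigma> \<beta> \<mu> z x y \<tau> xs ys
    by (rule grpda_l_run.intro[OF conj assms(2) sol assms(5-13)])
  show ?thesis by (rule iterates_converge)
qed

end
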